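(* Every $n$-node directed unweighted graph $G$ with a set $P$ of demand pairs of size $p=|P|$ admits an exact distance preserver with $\widetilde{O}(n^{5/6}p^{2/3}+n)$ edges.
   Context: Demand pairs $(s,t)\in P\subseteq V(G)\times V(G)$ satisfy that $t$ is reachable from $s$. An exact distance preserver of $G,P$ is a subgraph $H$ of $G$ with $\mathrm{dist}_H(s,t)=\mathrm{dist}_G(s,t)$ for all $(s,t)\in P$. $\widetilde{O}$ hides $\mathrm{polylog}(n)$ factors. *)

theory Defs
  imports
    Complex_Main
    "Graph_Theory.Pair_Digraph"
    "Graph_Theory.Digraph_Component"
    "Graph_Theory.Shortest_Path"
begin

text \<open>
  The infimum ranges over all walks from \<open>s\<close> to \<open>t\<close>. It is \<open>\<infinity>\<close> if \<open>t\<close> is not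
  reachable from \<open>s\<close>, in particular if one of them is not a vertex of the graph.
  The library defines \<open>\<mu>\<close> only under the assumption that the graph is well-formed.
\<close>

definition hop_dist :: "('a, 'b) pre_digraph \<Rightarrow> 'a \<Rightarrow> 'a \<Rightarrow> ereal" where
  "hop_dist G s t = wf_digraph.\<mu> G (\<lambda>_. 1) s t"

definition demand_pairs :: "('a, 'b) pre_digraph \<Rightarrow> ('a \<times> 'a) set \<Rightarrow> bool" where
  "demand_pairs G P \<longleftrightarrow> P \<subseteq> verts G \<times> verts G \<and> (\<forall>(s, t) \<in> P. s \<rightarrow>\<^sup>*\<^bsub>G\<^esub> t)"

definition exact_distance_preserver ::
    "('a, 'b) pre_digraph \<Rightarrow> ('a \<times> 'a) set \<Rightarrow> ('a, 'b) pre_digraph \<Rightarrow> bool" where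
  "exact_distance_preserver G P H \<longleftrightarrow>
     subgraph H G \<and> (\<forall>(s, t) \<in> P. hop_dist H s t = hop_dist G s t)"

text \<open>
  Polylogarithmic factors are powers of \<open>log\<^sub>2 (n + 1)\<close>; the shift only serves to make
  the factor at least \<open>1\<close> for all \<open>n \<ge> 1\<close>, where \<open>ln 1\<close> would vanish.
\<close>

definition polylog :: "nat \<Rightarrow> nat \<Rightarrow> real" where
  "polylog c n = log 2 (real n + 1) ^ c"

end

theory Submission
  imports Defs "HOL-Analysis.Convex"
begin

text \<open>
  Take shortest paths with consistent tie-breaking and charge every arc of their union to one path.
  Two paths charged at the same two vertices must then traverse them in opposite orders; this
  alone gives the bounds \<open>n p\<^sup>1\<^sup>/\<^sup>2\<close> (an ordered pair of vertices belongs to one path) and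
  \<open>n + n\<^sup>2\<^sup>/\<^sup>3 p\<close> (three paths cannot be pairwise opposed), which settle \<open>p \<ge> n\<close> and \<open>p \<le> n\<^sup>1\<^sup>/\<^sup>2\<close>.

  In between, unit arc lengths enter through round trips. If many paths come within round-trip
  distance \<open>r\<close> of a common hub, then outside \<open>O(r)\<close> arcs per path their distance from the hub
  increases, so opposite orders are impossible, two paths cross at most once, and the group
  costs \<open>O(n + n\<^sup>1\<^sup>/\<^sup>2 q + r q)\<close> for \<open>q\<close> paths. Remove such groups greedily. Afterwards every vertex is
  near few paths. Two paths that cross twice in opposite orders with a short round trip are near
  all vertices in between, so this forbids most short round trips, and long ones are few because
  they use up the lengths of the paths.
\<close>

section \<open>Families of sets traversed in opposite orders\<close>

lemma sum_if_eq_card: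
  assumes "finite A"
  shows "(\<Sum>a\<in>A. if R a then 1 else 0 :: nat) = card {a\<in>A. R a}"
  using assms by (simp add: sum.If_cases Int_def)

text \<open>Distinct positive integers sum to at least 1 + 2 + ... + k. The induction removes the
  maximum, which is at least the cardinality.\<close>

lemma card_square_le_two_sum:
  fixes S :: "nat set"
  assumes "finite S" "0 \<notin> S"
  shows "(card S)\<^sup>2 \<le> 2 * \<Sum>S"
  using assms
proof (induction "card S" arbitrary: S)
  case 0
  then show ?case by simp
next
  case (Suc k)
  then have ne: "S \<noteq> {}" by auto
  define m where "m = Max S"
  have m: "m \<in> S" unfolding m_def using Suc ne by auto
  have "S \<subseteq> {1..m}"
    using Suc.prems by (auto simp: m_def Suc_le_eq intro: gr0I)
  then have "card S \<le> m"
    using card_mono[of "{1..m}" S] by simp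
  moreover have "card (S - {m}) = k" using Suc m by simp
  then have "k\<^sup>2 \<le> 2 * \<Sum>(S - {m})"
    using Suc.hyps(1)[of "S - {m}"] Suc.prems by auto
  moreover have "\<Sum>S = m + \<Sum>(S - {m})"
    using m Suc.prems by (simp add: sum.remove)
  moreover have "(card S)\<^sup>2 = k\<^sup>2 + 2 * k + 1"
    unfolding Suc.hyps(2)[symmetric] by (simp add: power2_eq_square)
  ultimately show ?case
    using Suc.hyps(2) by simp
qed

text \<open>Cut the interval into blocks of length \<open>r\<close> starting at \<open>lo\<close>.
  Two isolated points differ by more than \<open>r\<close> and so lie in different blocks; the extra
  \<open>r\<close> pays for the last block.\<close>

lemma card_isolated_le:
  fixes S :: "int set" and r :: nat
  assumes "finite S" "S \<subseteq> {lo..hi}" "r > 0"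
  shows "card {x\<in>S. \<forall>y\<in>S. x < y \<longrightarrow> x + int r < y} * r \<le> nat (hi - lo) + r"
proof -
  define T where "T = {x\<in>S. \<forall>y\<in>S. x < y \<longrightarrow> x + int r < y}"
  show ?thesis
  proof (cases "S = {}")
    case False
    then have lohi: "lo \<le> hi" using assms(2) by force
    define f where "f x = nat ((x - lo) div int r)" for x
    have "inj_on f T"
    proof (rule linorder_inj_onI)
      fix x y assume xy: "x < y" "x \<in> T" "y \<in> T"
      then have lt: "x + int r < y" unfolding T_def by blast
      have "(x - lo) div int r + 1 = (x - lo + int r) div int r"
        using assms(3) by simp
      also have "\<dots> \<le> (y - lo) div int r"
        using lt by (intro zdiv_mono1) (use assms(3) in auto)
      finally have "(x - lo) div int r < (y - lo) div int r" by simp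
      moreover have "0 \<le> (x - lo) div int r"
        using xy assms unfolding T_def by (intro pos_imp_zdiv_nonneg_iff[THEN iffD2]) auto
      ultimately show "f x \<noteq> f y" unfolding f_def by simp
    qed auto
    moreover have "f ` T \<subseteq> {0..nat ((hi - lo) div int r)}"
      using assms unfolding f_def T_def
      by (auto 0 3 intro!: nat_mono zdiv_mono1 dest: subsetD)
    ultimately have "card T \<le> nat ((hi - lo) div int r) + 1"
      using card_mono[of "{0..nat ((hi - lo) div int r)}" "f ` T"] by (simp add: card_image)
    then have "card T * r \<le> (nat ((hi - lo) div int r) + 1) * r" by (rule mult_le_mono1)
    also have "\<dots> = nat (hi - lo) div r * r + r"
      using lohi by (simp add: nat_div_distrib algebra_simps)
    also have "\<dots> \<le> nat (hi - lo) + r" by simp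
    finally show ?thesis unfolding T_def .
  qed simp
qed

section \<open>Incidence counts in families traversed in opposite orders\<close>

locale opposed_family =
  fixes V :: "'a set" and Q :: "'p set" and K :: "'p \<Rightarrow> 'a set" and pos :: "'p \<Rightarrow> 'a \<Rightarrow> nat"
  assumes finite_V: "finite V" and finite_Q: "finite Q"
    and K_subset: "a \<in> Q \<Longrightarrow> K a \<subseteq> V"
    and pos_inj: "a \<in> Q \<Longrightarrow> inj_on (pos a) (K a)"
    and opposed: "\<lbrakk>a \<in> Q; b \<in> Q; a \<noteq> b; u \<in> K a; u \<in> K b; v \<in> K a; v \<in> K b; pos a u < pos a v\<rbrakk>
      \<Longrightarrow> pos b v < pos b u"
begin

text \<open>An element of \<open>K a\<close> will stand for an arc charged to the path
  \<open>a\<close>, represented by its head, so \<open>total\<close> will be the number of charged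
  arcs.\<close>

definition total :: nat where "total = (\<Sum>a\<in>Q. card (K a))"

definition mult :: "'a \<Rightarrow> nat" where "mult v = card {a\<in>Q. v \<in> K a}"

lemma finite_K: "a \<in> Q \<Longrightarrow> finite (K a)"
  using K_subset finite_V finite_subset by blast

lemma mult_eq: "mult v = (\<Sum>a\<in>Q. if v \<in> K a then 1 else 0)"
  unfolding mult_def using finite_Q by (simp add: sum_if_eq_card)

lemma sum_mem_eq_card: "A \<subseteq> V \<Longrightarrow> (\<Sum>v\<in>V. if v \<in> A then 1 else 0 :: nat) = card A"
  using finite_V by (simp add: sum_if_eq_card) (metis Collect_mem_eq Collect_conj_eq inf.absorb_iff2)

lemma sum_mult: "(\<Sum>v\<in>V. mult v) = total"
  unfolding mult_eq total_def
  by (subst sum.swap) (simp add: sum_mem_eq_card K_subset)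

lemma sum_mult2: "(\<Sum>v\<in>V. (mult v)\<^sup>2) = (\<Sum>a\<in>Q. \<Sum>b\<in>Q. card (K a \<inter> K b))"
proof -
  have "(\<Sum>v\<in>V. (mult v)\<^sup>2) = (\<Sum>v\<in>V. \<Sum>a\<in>Q. \<Sum>b\<in>Q. if v \<in> K a \<inter> K b then 1 else 0)"
    unfolding mult_eq power2_eq_square sum_product by (intro sum.cong) auto
  also have "\<dots> = (\<Sum>a\<in>Q. \<Sum>b\<in>Q. \<Sum>v\<in>V. if v \<in> K a \<inter> K b then 1 else 0)"
    by (subst sum.swap, intro sum.cong refl sum.swap)
  also have "\<dots> = (\<Sum>a\<in>Q. \<Sum>b\<in>Q. card (K a \<inter> K b))"
    using K_subset by (intro sum.cong refl sum_mem_eq_card) blast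
  finally show ?thesis .
qed

lemma sum_mult3: "(\<Sum>v\<in>V. mult v ^ 3) = (\<Sum>a\<in>Q. \<Sum>b\<in>Q. \<Sum>c\<in>Q. card (K a \<inter> K b \<inter> K c))"
proof -
  have "(\<Sum>v\<in>V. mult v ^ 3) =
      (\<Sum>v\<in>V. \<Sum>a\<in>Q. \<Sum>b\<in>Q. \<Sum>c\<in>Q. if v \<in> K a \<inter> K b \<inter> K c then 1 else 0)"
    unfolding mult_eq power3_eq_cube sum_product sum_distrib_right
    by (intro sum.cong refl) (auto simp: sum_distrib_left intro!: sum.cong)
  also have "\<dots> = (\<Sum>a\<in>Q. \<Sum>b\<in>Q. \<Sum>c\<in>Q. \<Sum>v\<in>V. if v \<in> K a \<inter> K b \<inter> K c then 1 else 0)"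
    by (subst sum.swap, intro sum.cong refl, subst sum.swap, intro sum.cong refl, rule sum.swap)
  also have "\<dots> = (\<Sum>a\<in>Q. \<Sum>b\<in>Q. \<Sum>c\<in>Q. card (K a \<inter> K b \<inter> K c))"
    using K_subset by (intro sum.cong refl sum_mem_eq_card) blast
  finally show ?thesis .
qed

text \<open>The sum runs over ordered pairs, which makes it exactly the off-diagonal part of the
  second moment of \<open>mult\<close>.\<close>

definition crossings :: nat where
  "crossings = (\<Sum>a\<in>Q. \<Sum>b\<in>Q - {a}. card (K a \<inter> K b))"

lemma sum_mult2_eq: "(\<Sum>v\<in>V. (mult v)\<^sup>2) = total + crossings"
proof -
  have "(\<Sum>b\<in>Q. card (K a \<inter> K b)) = card (K a) + (\<Sum>b\<in>Q - {a}. card (K a \<inter> K b))" if "a \<in> Q" for a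
    using sum.remove[OF finite_Q that, of "\<lambda>b. card (K a \<inter> K b)"] by simp
  then show ?thesis
    unfolding sum_mult2 total_def crossings_def by (simp add: sum.distrib)
qed

text \<open>Cauchy-Schwarz over the vertices. Bounds on \<open>crossings\<close> turn into bounds on
  \<open>total\<close> through this inequality.\<close>

lemma total_square_le: "total\<^sup>2 \<le> card V * (total + crossings)"
proof -
  have "(real total)\<^sup>2 = (\<Sum>v\<in>V. real (mult v))\<^sup>2"
    unfolding sum_mult[symmetric] by simp
  also have "\<dots> \<le> (\<Sum>v\<in>V. (real (mult v))\<^sup>2) * card V"
    using sum_squared_le_sum_of_squares by blast
  also have "\<dots> = real (card V * (total + crossings))"
    unfolding sum_mult2_eq[symmetric] by simp
  finally show ?thesis by (simp only: of_nat_power[symmetric] of_nat_le_iff)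
qed

section \<open>Bounds from opposition and from single crossings\<close>

lemma card_Int_triple_le_1:
  assumes "a \<in> Q" "b \<in> Q" "c \<in> Q" "a \<noteq> b" "b \<noteq> c" "a \<noteq> c"
  shows "card (K a \<inter> K b \<inter> K c) \<le> 1"
proof (rule ccontr)
  assume "\<not> ?thesis"
  then obtain u v where uv: "u \<in> K a \<inter> K b \<inter> K c" "v \<in> K a \<inter> K b \<inter> K c" "u \<noteq> v"
    by (metis One_nat_def card_le_Suc0_iff_eq finite_Int finite_K assms(1))
  \<comment> \<open>Being opposed to \<open>a\<close> makes \<open>b\<close> and \<open>c\<close>
    agree on the order of the two vertices, but these two are opposed as well.\<close>
  have *: False if "pos a u < pos a v" "u \<in> K a \<inter> K b \<inter> K c" "v \<in> K a \<inter> K b \<inter> K c" for u v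
  proof -
    have "pos b v < pos b u" "pos c v < pos c u"
      using opposed[of a b u v] opposed[of a c u v] that assms by auto
    moreover have "pos c u < pos c v"
      using opposed[of b c v u] that assms calculation by auto
    ultimately show False by simp
  qed
  have "pos a u \<noteq> pos a v" using pos_inj[OF assms(1)] uv by (auto dest: inj_onD)
  then show False using * uv by (meson linorder_neqE_nat)
qed

text \<open>By \<open>card_Int_triple_le_1\<close> the third moment of \<open>mult\<close> exceeds
  three times the second by at most q^3, for q paths. A pointwise inequality between m and m^3 - 3
  m^2 turns this into a bound on the first moment.\<close>

lemma total_le_triple: "real total \<le> 15 * real (card V) + 3 * root 3 (card V) ^ 2 * real (card Q)"
proof (cases "card V = 0")
  case True
  then show ?thesis using sum_mult finite_V by simp
next
  case False
  define n where "n = root 3 (real (card V))"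
  have n: "n > 0" "n ^ 3 = card V" using False unfolding n_def by auto
  define q where "q = real (card Q)"
  have q: "q \<ge> 0" unfolding q_def by simp
  define S2 where "S2 = (\<Sum>v\<in>V. (mult v)\<^sup>2)"
  define S3 where "S3 = (\<Sum>v\<in>V. mult v ^ 3)"
  have "card (K a \<inter> K b \<inter> K c) \<le> 1 + (if a = b then card (K b \<inter> K c) else 0)
      + (if b = c then card (K a \<inter> K b) else 0) + (if c = a then card (K a \<inter> K b) else 0)"
    if "a \<in> Q" "b \<in> Q" "c \<in> Q" for a b c
    using card_Int_triple_le_1[OF that] by (auto simp: Int_ac)
  then have "S3 \<le> (\<Sum>a\<in>Q. \<Sum>b\<in>Q. \<Sum>c\<in>Q. 1 + (if a = b then card (K b \<inter> K c) else 0)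
      + (if b = c then card (K a \<inter> K b) else 0) + (if c = a then card (K a \<inter> K b) else 0))"
    unfolding S3_def sum_mult3 by (intro sum_mono)
  also have "\<dots> = card Q ^ 3 + (\<Sum>a\<in>Q. \<Sum>b\<in>Q. \<Sum>c\<in>Q. if a = b then card (K b \<inter> K c) else 0)
      + (\<Sum>a\<in>Q. \<Sum>b\<in>Q. \<Sum>c\<in>Q. if b = c then card (K a \<inter> K b) else 0)
      + (\<Sum>a\<in>Q. \<Sum>b\<in>Q. \<Sum>c\<in>Q. if c = a then card (K a \<inter> K b) else 0)"
    unfolding sum.distrib by (simp add: power3_eq_cube)
  also have "(\<Sum>a\<in>Q. \<Sum>b\<in>Q. \<Sum>c\<in>Q. if a = b then card (K b \<inter> K c) else 0) = S2"
  proof -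
    have "(\<Sum>c\<in>Q. if a = b then card (K b \<inter> K c) else 0)
        = (if a = b then \<Sum>c\<in>Q. card (K b \<inter> K c) else 0)" for a b
      by simp
    then show ?thesis unfolding S2_def sum_mult2 using finite_Q by simp
  qed
  also have "(\<Sum>a\<in>Q. \<Sum>b\<in>Q. \<Sum>c\<in>Q. if b = c then card (K a \<inter> K b) else 0) = S2"
    unfolding S2_def sum_mult2 using finite_Q by simp
  also have "(\<Sum>a\<in>Q. \<Sum>b\<in>Q. \<Sum>c\<in>Q. if c = a then card (K a \<inter> K b) else 0) = S2"
    unfolding S2_def sum_mult2 using finite_Q by simp
  finally have S: "S3 \<le> card Q ^ 3 + 3 * S2" by simp
  \<comment> \<open>If \<open>mult\<close> were constant with third moment q^3, its value would be q
    / \<open>n\<close>, as \<open>n\<close> is the cube root of \<open>card V\<close>. Adding 1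
    keeps \<open>t\<close> at least 1.\<close>
  define t where "t = 1 + q / n"
  have t: "t \<ge> 1" unfolding t_def using n q by simp
  \<comment> \<open>For m >= 6 the bracket is at least m^3 / 2, and m t^2 is at most the larger of
    t^3 and m^3. For m <= 5 twice the bracket is at least -8, and 14 = 6 + 8.\<close>
  have pw: "real m * t\<^sup>2 \<le> 14 * t\<^sup>2 + t ^ 3 + 2 * (real m ^ 3 - 3 * (real m)\<^sup>2)" for m :: nat
  proof (cases "m \<ge> 6")
    case True
    have "real m * t\<^sup>2 \<le> t ^ 3 + real m ^ 3"
    proof (cases "real m \<le> t")
      case True
      then have "real m * t\<^sup>2 \<le> t * t\<^sup>2" by (intro mult_right_mono) auto
      then show ?thesis by (simp add: power2_eq_square power3_eq_cube add_increasing2)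
    next
      case False
      then have "real m * t\<^sup>2 \<le> real m * (real m)\<^sup>2" using t by (intro mult_left_mono power_mono) auto
      then show ?thesis using t by (simp add: power2_eq_square power3_eq_cube add_increasing)
    qed
    also have "6 * (real m)\<^sup>2 \<le> real m * (real m)\<^sup>2" using True by (intro mult_right_mono) auto
    then have "real m ^ 3 \<le> 2 * (real m ^ 3 - 3 * (real m)\<^sup>2)"
      by (simp add: power2_eq_square power3_eq_cube)
    finally show ?thesis by (smt (verit) zero_le_power2)
  next
    case False
    then have "m \<in> {0,1,2,3,4,5}" by auto
    then have "real m \<le> 6" "2 * (real m ^ 3 - 3 * (real m)\<^sup>2) \<ge> -8" by auto
    moreover have "1 \<le> t\<^sup>2" using t by simp
    moreover have "real m * t\<^sup>2 \<le> 6 * t\<^sup>2" using calculation by (intro mult_right_mono) auto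
    moreover have "t ^ 3 \<ge> 0" using t by simp
    ultimately show ?thesis by linarith
  qed
  have "real total * t\<^sup>2 = (\<Sum>v\<in>V. real (mult v) * t\<^sup>2)"
    unfolding sum_mult[symmetric] by (simp add: sum_distrib_right)
  also have "\<dots> \<le> (\<Sum>v\<in>V. 14 * t\<^sup>2 + t ^ 3 + 2 * (real (mult v) ^ 3 - 3 * (real (mult v))\<^sup>2))"
    by (intro sum_mono pw)
  also have "\<dots> = card V * (14 * t\<^sup>2 + t ^ 3) + 2 * (real S3 - 3 * real S2)"
    unfolding S2_def S3_def by (simp add: sum.distrib sum_subtractf sum_distrib_left algebra_simps)
  also have "real S3 - 3 * real S2 \<le> q ^ 3"
    using S unfolding q_def by (metis (no_types, opaque_lifting) diff_le_eq of_nat_add of_nat_le_iff of_nat_mult of_nat_numeral of_nat_power)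
  finally have *: "real total * t\<^sup>2 \<le> n ^ 3 * (14 * t\<^sup>2 + t ^ 3) + 2 * q ^ 3"
    using n by simp
  have "q \<le> n * t" unfolding t_def using n q by (simp add: field_simps)
  then have "q * q\<^sup>2 \<le> q * (n * t)\<^sup>2" using q by (intro mult_left_mono power_mono) auto
  then have "q ^ 3 \<le> q * n\<^sup>2 * t\<^sup>2" by (simp add: power2_eq_square power3_eq_cube algebra_simps)
  with * have "real total * t\<^sup>2 \<le> (n ^ 3 * (14 + t) + 2 * q * n\<^sup>2) * t\<^sup>2"
    by (simp add: algebra_simps power2_eq_square power3_eq_cube)
  then have "real total \<le> n ^ 3 * (14 + t) + 2 * q * n\<^sup>2"
    using t by (simp add: mult_le_cancel_right)
  also have "\<dots> = 15 * n ^ 3 + 3 * n\<^sup>2 * q"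
    unfolding t_def using n by (simp add: field_simps power2_eq_square power3_eq_cube)
  finally show ?thesis using n unfolding q_def n_def by simp
qed

text \<open>There are at most q^2 crossings, so \<open>total_square_le\<close> becomes I^2 <= N (I +
  q^2), with N vertices, q paths and I for \<open>total\<close>. The bound solves this quadratic
  inequality.\<close>

lemma total_le_single_crossing:
  assumes "\<And>a b. a \<in> Q \<Longrightarrow> b \<in> Q \<Longrightarrow> a \<noteq> b \<Longrightarrow> card (K a \<inter> K b) \<le> 1"
  shows "real total \<le> card V + sqrt (card V) * card Q"
proof -
  have "crossings \<le> (\<Sum>a\<in>Q. \<Sum>b\<in>Q - {a}. 1)"
    unfolding crossings_def using assms by (intro sum_mono) auto
  also have "\<dots> \<le> (\<Sum>a\<in>Q. card Q)" by (intro sum_mono) (simp add: card_Diff_subset_Int finite_Q)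
  finally have "crossings \<le> card Q * card Q" by simp
  with total_square_le have "total\<^sup>2 \<le> card V * (total + card Q * card Q)"
    by (meson add_left_mono le_trans mult_le_mono2)
  then have "real (total\<^sup>2) \<le> real (card V * (total + card Q * card Q))" by (simp only: of_nat_le_iff)
  then have *: "(real total)\<^sup>2 \<le> card V * total + (sqrt (card V) * card Q)\<^sup>2"
    by (simp add: algebra_simps power2_eq_square)
  show ?thesis
  proof (rule ccontr)
    assume "\<not> ?thesis"
    then have a: "real total > card V + sqrt (card V) * card Q" by simp
    have b: "sqrt (card V) * card Q \<ge> 0" by simp
    define x where "x = sqrt (card V) * card Q"
    have "x * x \<le> real total * x" using a b unfolding x_def by (intro mult_right_mono) auto
    moreover have "real total * (card V + x) < real total * real total"
      using a b unfolding x_def by (intro mult_strict_left_mono) linarith+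
    ultimately have "card V * total + x\<^sup>2 < (real total)\<^sup>2"
      by (simp add: power2_eq_square algebra_simps)
    then show False using * unfolding x_def by simp
  qed
qed

text \<open>An ordered pair of vertices is traversed in this order by at most one path, so up to a
  linear term the squares of the \<open>card (K a)\<close> sum to at most twice the square of
  \<open>card V\<close>. Cauchy-Schwarz over the paths then bounds \<open>total\<close>.\<close>

lemma total_le_pairs: "real total \<le> 2 * card Q + 2 * card V * sqrt (card Q)"
proof -
  define A where "A a = {(u, v). u \<in> K a \<and> v \<in> K a \<and> pos a u < pos a v}" for a
  have A_sub: "A a \<subseteq> V \<times> V" if "a \<in> Q" for a using K_subset[OF that] unfolding A_def by auto
  have fin: "finite (A a)" if "a \<in> Q" for a using A_sub[OF that] finite_V by (meson finite_SigmaI finite_subset)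
  have disj: "A a \<inter> A b = {}" if "a \<in> Q" "b \<in> Q" "a \<noteq> b" for a b
    using opposed[OF that] unfolding A_def by (auto dest: less_asym)
  have "(\<Sum>a\<in>Q. card (A a)) = card (\<Union>a\<in>Q. A a)"
    using fin disj finite_Q by (intro card_UN_disjoint[symmetric]) auto
  also have "\<dots> \<le> card (V \<times> V)"
    using A_sub finite_V by (intro card_mono) auto
  finally have 1: "(\<Sum>a\<in>Q. card (A a)) \<le> (card V)\<^sup>2" by (simp add: card_cartesian_product power2_eq_square)
  have 2: "(card (K a))\<^sup>2 \<le> card (K a) + 2 * card (A a)" if "a \<in> Q" for a
  proof -
    have "K a \<times> K a \<subseteq> (\<lambda>u. (u, u)) ` K a \<union> (A a \<union> prod.swap ` A a)"
    proof
      fix z assume z: "z \<in> K a \<times> K a"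
      obtain u v where uv: "z = (u, v)" "u \<in> K a" "v \<in> K a" using z by auto
      have "u = v \<or> pos a u < pos a v \<or> pos a v < pos a u"
        using uv pos_inj[OF that] by (metis inj_onD linorder_neqE_nat)
      then show "z \<in> (\<lambda>u. (u, u)) ` K a \<union> (A a \<union> prod.swap ` A a)"
        using uv unfolding A_def by force
    qed
    then have "card (K a \<times> K a) \<le> card ((\<lambda>u. (u, u)) ` K a \<union> (A a \<union> prod.swap ` A a))"
      using fin finite_K that by (intro card_mono) auto
    also have "\<dots> \<le> card ((\<lambda>u. (u, u)) ` K a) + (card (A a) + card (prod.swap ` A a))"
      by (meson add_left_mono card_Un_le le_trans)
    also have "\<dots> \<le> card (K a) + (card (A a) + card (A a))"
      using fin finite_K that by (intro add_mono card_image_le) auto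
    finally show ?thesis by (simp add: card_cartesian_product power2_eq_square)
  qed
  have "(\<Sum>a\<in>Q. (card (K a))\<^sup>2) \<le> (\<Sum>a\<in>Q. card (K a) + 2 * card (A a))"
    using 2 by (intro sum_mono)
  also have "\<dots> \<le> total + 2 * (card V)\<^sup>2"
    using 1 unfolding total_def by (simp add: sum.distrib flip: sum_distrib_left)
  finally have "real (\<Sum>a\<in>Q. (card (K a))\<^sup>2) \<le> real (total + 2 * (card V)\<^sup>2)" by (simp only: of_nat_le_iff)
  then have 3: "(\<Sum>a\<in>Q. (real (card (K a)))\<^sup>2) \<le> total + 2 * (real (card V))\<^sup>2" by simp
  have "(real total)\<^sup>2 \<le> (\<Sum>a\<in>Q. (real (card (K a)))\<^sup>2) * card Q"
    unfolding total_def of_nat_sum by (rule sum_squared_le_sum_of_squares)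
  also have "\<dots> \<le> (total + 2 * (real (card V))\<^sup>2) * card Q"
    using 3 by (rule mult_right_mono) simp
  finally have 4: "(real total)\<^sup>2 \<le> (total + 2 * (real (card V))\<^sup>2) * card Q" .
  show ?thesis
  \<comment> \<open>If \<open>total\<close> exceeds twice the number of paths, the term linear in
    \<open>total\<close> is at most half of the left side and is absorbed there.\<close>
  proof (cases "real total \<le> 2 * card Q")
    case True
    then show ?thesis by (simp add: add_increasing2)
  next
    case False
    then have "2 * real (card Q) * total \<le> total * real total"
      by (intro mult_right_mono) auto
    with 4 have "(real total)\<^sup>2 \<le> 4 * (real (card V))\<^sup>2 * card Q"
      by (simp add: algebra_simps power2_eq_square)
    also have "\<dots> = (2 * real (card V) * sqrt (card Q))\<^sup>2"
      by (simp add: power_mult_distrib)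
    finally have "real total \<le> 2 * real (card V) * sqrt (card Q)"
      by (rule power2_le_imp_le) simp
    then show ?thesis by simp
  qed
qed

section \<open>Crossings when every vertex is near few paths\<close>

context
  fixes len :: "'p \<Rightarrow> nat" and near :: "'a \<Rightarrow> 'p \<Rightarrow> bool" and r :: nat
  assumes pos_le: "\<lbrakk>a \<in> Q; v \<in> K a\<rbrakk> \<Longrightarrow> pos a v \<le> len a"
    and near: "\<lbrakk>a \<in> Q; b \<in> Q; a \<noteq> b; v \<in> K a \<inter> K b; u \<in> K a \<inter> K b; z \<in> K a; pos a v < pos a z;
      pos a z \<le> pos a u; pos a u - pos a v + (pos b v - pos b u) \<le> r\<rbrakk> \<Longrightarrow> near z b"
    and r_pos: "r > 0"
begin

text \<open>For distinct paths of the family the sum compared with \<open>r\<close> is the length of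
  a round trip: from \<open>v\<close> to \<open>u\<close> along \<open>a\<close>, and back along
  \<open>b\<close>, which meets \<open>u\<close> first.\<close>

definition close :: "'p \<Rightarrow> 'p \<Rightarrow> 'a set" where
  "close a b = {v \<in> K a \<inter> K b. \<exists>u\<in>K a \<inter> K b. pos a v < pos a u \<and>
     pos a u - pos a v + (pos b v - pos b u) \<le> r}"

text \<open>The next crossing itself belongs to the gap, so the gap at a close vertex is nonempty.
  There the gap lies on a short round trip, hence its vertices are near \<open>b\<close>.\<close>

definition gap :: "'p \<Rightarrow> 'p \<Rightarrow> 'a \<Rightarrow> 'a set" where
  "gap a b v = {z \<in> K a. pos a v < pos a z \<and>
     (\<forall>w\<in>K a \<inter> K b. pos a v < pos a w \<longrightarrow> pos a z \<le> pos a w)}"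

text \<open>Along the common vertices of two opposed paths the difference of the two positions is
  strictly increasing, and it increases by the length of the round trip.\<close>

lemma card_not_close_le:
  assumes "a \<in> Q" "b \<in> Q" "a \<noteq> b"
  shows "real (card (K a \<inter> K b - close a b)) \<le> 1 + (len a + len b) / r"
proof -
  define s where "s v = int (pos a v) - int (pos b v)" for v
  let ?X = "K a \<inter> K b"
  have s_less: "s u < s v \<longleftrightarrow> pos a u < pos a v" if "u \<in> ?X" "v \<in> ?X" for u v
  proof -
    have "pos a u < pos a v \<Longrightarrow> s u < s v" if "u \<in> ?X" "v \<in> ?X" for u v
      using opposed[OF assms, of u v] that unfolding s_def by auto
    moreover have "u = v" if "pos a u = pos a v"
      using pos_inj[OF assms(1)] that \<open>u \<in> ?X\<close> \<open>v \<in> ?X\<close> by (auto dest: inj_onD)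
    ultimately show ?thesis
      using that by (metis less_asym linorder_neqE_nat order_less_irrefl)
  qed
  have inj: "inj_on s ?X"
  proof (rule inj_onI)
    fix u v assume uv: "u \<in> ?X" "v \<in> ?X" "s u = s v"
    then have "pos a u = pos a v" using s_less[of u v] s_less[of v u] by simp
    then show "u = v" using pos_inj[OF assms(1)] uv by (auto dest: inj_onD)
  qed
  \<comment> \<open>From a vertex that is not close, every later common vertex completes a round
    trip longer than \<open>r\<close>, so its value of \<open>s\<close> is isolated as in
    \<open>card_isolated_le\<close>.\<close>
  have "s ` (?X - close a b) \<subseteq> {x\<in>s ` ?X. \<forall>y\<in>s ` ?X. x < y \<longrightarrow> x + int r < y}"
  proof clarify
    fix v assume v: "v \<in> K a" "v \<in> K b" "v \<notin> close a b"
    have "s v + int r < s u" if u: "u \<in> ?X" "s v < s u" for u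
    proof -
      have "pos a v < pos a u" using s_less u v by blast
      moreover from this have "pos b u < pos b v" using opposed[OF assms, of v u] u v by auto
      moreover have "\<not> pos a u - pos a v + (pos b v - pos b u) \<le> r"
        using u v calculation unfolding close_def by blast
      ultimately show ?thesis unfolding s_def by linarith
    qed
    then show "s v \<in> s ` ?X \<and> (\<forall>y\<in>s ` ?X. s v < y \<longrightarrow> s v + int r < y)"
      using v by auto
  qed
  moreover have fin: "finite ?X" using finite_K assms by auto
  ultimately have "card (s ` (?X - close a b)) \<le> card {x\<in>s ` ?X. \<forall>y\<in>s ` ?X. x < y \<longrightarrow> x + int r < y}"
    by (intro card_mono) auto
  moreover have "card (s ` (?X - close a b)) = card (?X - close a b)"
    using inj by (intro card_image) (auto intro: inj_on_subset)
  moreover have "s ` ?X \<subseteq> {- int (len b)..int (len a)}"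
    using pos_le assms unfolding s_def by (force simp: algebra_simps)
  note card_isolated_le[OF finite_imageI[OF fin] this r_pos]
  ultimately have "card (?X - close a b) * r \<le> len a + len b + r"
    by (simp add: nat_int_add) (meson le_trans mult_le_mono1)
  then have "real (card (?X - close a b) * r) \<le> real (len a + len b + r)" by (simp only: of_nat_le_iff)
  then show ?thesis using r_pos by (simp add: field_simps)
qed

text \<open>The witness of closeness can be replaced by the first crossing after \<open>v\<close>:
  moving back to it does not lengthen the leg on \<open>a\<close> and, by opposition, not the leg on
  \<open>b\<close> either.\<close>

lemma gap_eq:
  assumes "a \<in> Q" "b \<in> Q" "a \<noteq> b" "v \<in> close a b"
  obtains u where "u \<in> K a \<inter> K b" "pos a v < pos a u"
    "pos a u - pos a v + (pos b v - pos b u) \<le> r"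
    "gap a b v = {z \<in> K a. pos a v < pos a z \<and> pos a z \<le> pos a u}"
proof -
  let ?P = "\<lambda>w. w \<in> K a \<inter> K b \<and> pos a v < pos a w"
  obtain u0 where u0: "?P u0" "pos a u0 - pos a v + (pos b v - pos b u0) \<le> r"
    using assms(4) unfolding close_def by blast
  define u where "u = arg_min (pos a) ?P"
  have u: "?P u" unfolding u_def by (rule arg_min_natI) (rule u0(1))
  have min: "pos a u \<le> pos a w" if "?P w" for w unfolding u_def by (rule arg_min_nat_le) (rule that)
  have "pos b u0 \<le> pos b u"
  proof (cases "u = u0")
    case False
    then have "pos a u < pos a u0"
      using min[OF u0(1)] pos_inj[OF assms(1)] u u0(1) by (metis IntD1 inj_onD le_neq_implies_less)
    then show ?thesis using opposed[OF assms(1-3), of u u0] u u0(1) by auto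
  qed simp
  then have "pos a u - pos a v + (pos b v - pos b u) \<le> r"
    using u0 min[OF u0(1)] by linarith
  moreover have "gap a b v = {z \<in> K a. pos a v < pos a z \<and> pos a z \<le> pos a u}"
    unfolding gap_def using u min by fastforce
  ultimately show thesis using that u by blast
qed

text \<open>For fixed \<open>a\<close> and \<open>v\<close> the gaps have distinct sizes, so many close crossings at \<open>v\<close> force
  a quadratic total gap, while lightness bounds the total gap linearly.\<close>

lemma gap_card_inj:
  assumes "a \<in> Q"
  shows "inj_on (\<lambda>b. card (gap a b v)) {b \<in> Q - {a}. v \<in> close a b}"
proof (rule inj_onI, rule ccontr)
  fix b c assume b: "b \<in> {b \<in> Q - {a}. v \<in> close a b}" and c: "c \<in> {b \<in> Q - {a}. v \<in> close a b}"
    and eq: "card (gap a b v) = card (gap a c v)" and "b \<noteq> c"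
  obtain u where u: "u \<in> K a \<inter> K b" "pos a v < pos a u"
    "gap a b v = {z \<in> K a. pos a v < pos a z \<and> pos a z \<le> pos a u}"
    using gap_eq[OF assms, of b v] b by blast
  obtain w where w: "w \<in> K a \<inter> K c" "pos a v < pos a w"
    "gap a c v = {z \<in> K a. pos a v < pos a z \<and> pos a z \<le> pos a w}"
    using gap_eq[OF assms, of c v] c by blast
  have v: "v \<in> K a" "v \<in> K b" "v \<in> K c" using b c unfolding close_def by auto
  have *: "card {z \<in> K a. pos a v < pos a z \<and> pos a z \<le> pos a x} <
      card {z \<in> K a. pos a v < pos a z \<and> pos a z \<le> pos a y}"
    if "pos a x < pos a y" "pos a v < pos a y" "y \<in> K a" for x y
  proof (rule psubset_card_mono)
    show "{z \<in> K a. pos a v < pos a z \<and> pos a z \<le> pos a x} \<subset> {z \<in> K a. pos a v < pos a z \<and> pos a z \<le> pos a y}"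
      using that by (intro psubsetI) (fastforce, metis (no_types, lifting) leD le_refl mem_Collect_eq)
  qed (use finite_K[OF assms] in auto)
  \<comment> \<open>Gaps of equal size end at the same vertex. Then \<open>b\<close> and
    \<open>c\<close>, both opposed to \<open>a\<close>, traverse \<open>u\<close> and
    \<open>v\<close> in the same order, although they are opposed to each other.\<close>
  have "pos a u = pos a w"
  proof (rule ccontr)
    assume "pos a u \<noteq> pos a w"
    then consider "pos a u < pos a w" | "pos a w < pos a u" by linarith
    then show False using *[of u w] *[of w u] u w eq by cases auto
  qed
  then have "u = w" using u w pos_inj[OF assms] by (auto dest: inj_onD)
  then have "pos b u < pos b v" "pos c u < pos c v"
    using opposed[of a b v u] opposed[of a c v u] assms b c u w v by auto
  moreover have "pos c v < pos c u"
    using opposed[of b c u v] \<open>b \<noteq> c\<close> b c u w v \<open>u = w\<close> calculation by auto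
  ultimately show False by simp
qed

text \<open>The double sum pays for the crossings that are not close, by
  \<open>card_not_close_le\<close>. The term with \<open>sqrt (2 * D)\<close> pays for the close
  ones, counted as the sizes of the sets \<open>B a v\<close> over all incidences.\<close>

lemma crossings_le:
  fixes D :: real
  assumes light: "\<And>z. z \<in> V \<Longrightarrow> real (card {b\<in>Q. near z b}) \<le> D"
  shows "real crossings \<le> (\<Sum>a\<in>Q. \<Sum>b\<in>Q. 1 + (len a + len b) / r) + total * sqrt (2 * D)"
proof -
  define B where "B a v = {b \<in> Q - {a}. v \<in> close a b}" for a v
  have close_sub: "close a b \<subseteq> K a" for a b unfolding close_def by auto
  have square: "(card (B a v))\<^sup>2 \<le> 2 * (\<Sum>b\<in>B a v. card (gap a b v))" if "a \<in> Q" for a v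
  proof -
    have inj: "inj_on (\<lambda>b. card (gap a b v)) (B a v)"
      unfolding B_def by (rule gap_card_inj[OF that])
    have "gap a b v \<noteq> {}" if "b \<in> B a v" for b
      using gap_eq[OF \<open>a \<in> Q\<close>, of b v] that unfolding B_def by blast
    moreover have "finite (gap a b v)" for b unfolding gap_def using finite_K[OF that] by auto
    ultimately have "0 \<notin> (\<lambda>b. card (gap a b v)) ` B a v" by auto
    moreover have "finite (B a v)" unfolding B_def using finite_Q by auto
    ultimately have "(card ((\<lambda>b. card (gap a b v)) ` B a v))\<^sup>2 \<le> 2 * \<Sum>((\<lambda>b. card (gap a b v)) ` B a v)"
      by (intro card_square_le_two_sum) auto
    then show ?thesis using inj by (simp add: card_image sum.reindex)
  qed
  \<comment> \<open>For fixed \<open>a\<close> and \<open>b\<close> the gaps are disjoint and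
    consist of vertices near \<open>b\<close>. Summed over \<open>b\<close>, each vertex of
    \<open>K a\<close> is counted at most \<open>D\<close> times.\<close>
  have gaps: "real (\<Sum>v\<in>K a. \<Sum>b\<in>B a v. card (gap a b v)) \<le> D * card (K a)" if a: "a \<in> Q" for a
  proof -
    have "(\<Sum>v\<in>K a. \<Sum>b\<in>B a v. card (gap a b v)) = (\<Sum>b\<in>Q - {a}. \<Sum>v\<in>close a b. card (gap a b v))"
      unfolding B_def using finite_K[OF a] finite_Q close_sub
      by (subst sum.swap_restrict) (auto intro!: sum.cong)
    also have "\<dots> \<le> (\<Sum>b\<in>Q - {a}. card {z\<in>K a. near z b})"
    proof (rule sum_mono)
      fix b assume b: "b \<in> Q - {a}"
      have "(\<Sum>v\<in>close a b. card (gap a b v)) = card (\<Union>v\<in>close a b. gap a b v)"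
      proof (rule card_UN_disjoint[symmetric])
        show "finite (close a b)" using finite_K[OF a] close_sub finite_subset by blast
        show "\<forall>v\<in>close a b. finite (gap a b v)" unfolding gap_def using finite_K[OF a] by auto
        have *: "gap a b v \<inter> gap a b w = {}"
          if "v \<in> close a b" "w \<in> close a b" "pos a v < pos a w" for v w
          using that unfolding gap_def close_def by fastforce
        show "\<forall>v\<in>close a b. \<forall>w\<in>close a b. v \<noteq> w \<longrightarrow> gap a b v \<inter> gap a b w = {}"
        proof (intro ballI impI)
          fix v w assume vw: "v \<in> close a b" "w \<in> close a b" "v \<noteq> w"
          then have "pos a v \<noteq> pos a w"
            using pos_inj[OF a] close_sub by (metis inj_onD subsetD)
          then show "gap a b v \<inter> gap a b w = {}"
            using *[of v w] *[of w v] vw by (auto simp: Int_commute neq_iff)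
        qed
      qed
      also have "\<dots> \<le> card {z\<in>K a. near z b}"
      proof (rule card_mono)
        show "(\<Union>v\<in>close a b. gap a b v) \<subseteq> {z\<in>K a. near z b}"
        proof clarify
          fix v z assume v: "v \<in> close a b" and z: "z \<in> gap a b v"
          obtain u where u: "u \<in> K a \<inter> K b" "pos a u - pos a v + (pos b v - pos b u) \<le> r"
            "gap a b v = {z \<in> K a. pos a v < pos a z \<and> pos a z \<le> pos a u}"
            using gap_eq[OF a, of b v] b v by blast
          then show "z \<in> K a \<and> near z b"
            using near[OF a, of b v u z] b v z unfolding close_def by auto
        qed
      qed (use finite_K[OF a] in auto)
      finally show "(\<Sum>v\<in>close a b. card (gap a b v)) \<le> card {z\<in>K a. near z b}" .
    qed
    also have "\<dots> \<le> (\<Sum>b\<in>Q. card {z\<in>K a. near z b})"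
      using finite_Q by (intro sum_mono2) auto
    also have "\<dots> = (\<Sum>b\<in>Q. \<Sum>z | z \<in> K a \<and> near z b. 1)" by simp
    also have "\<dots> = (\<Sum>z\<in>K a. \<Sum>b | b \<in> Q \<and> near z b. 1)"
      by (rule sum.swap_restrict) (use finite_K[OF a] finite_Q in auto)
    finally have "real (\<Sum>v\<in>K a. \<Sum>b\<in>B a v. card (gap a b v)) \<le> real (\<Sum>z\<in>K a. card {b\<in>Q. near z b})"
      by (simp add: sum_nonneg flip: of_nat_sum)
    also have "\<dots> = (\<Sum>z\<in>K a. real (card {b\<in>Q. near z b}))" by simp
    also have "\<dots> \<le> (\<Sum>z\<in>K a. D)" using light K_subset[OF a] by (intro sum_mono) auto
    finally show ?thesis by (simp add: mult.commute)
  qed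
  define C where "C = (\<Sum>a\<in>Q. \<Sum>b\<in>Q - {a}. card (close a b))"
  have C_eq: "C = (\<Sum>(a, v)\<in>Sigma Q K. card (B a v))"
  proof -
    have "(\<Sum>b\<in>Q - {a}. card (close a b)) = (\<Sum>v\<in>K a. card (B a v))" if a: "a \<in> Q" for a
    proof -
      have "(\<Sum>b\<in>Q - {a}. card (close a b)) = (\<Sum>b\<in>Q - {a}. \<Sum>v | v \<in> K a \<and> v \<in> close a b. 1)"
        using close_sub by (intro sum.cong) (auto intro!: arg_cong[where f = card])
      also have "\<dots> = (\<Sum>v\<in>K a. \<Sum>b | b \<in> Q - {a} \<and> v \<in> close a b. 1)"
        by (rule sum.swap_restrict) (use finite_K[OF a] finite_Q in auto)
      finally show ?thesis unfolding B_def by simp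
    qed
    then show ?thesis unfolding C_def using finite_Q finite_K by (simp add: sum.Sigma)
  qed
  \<comment> \<open>Cauchy-Schwarz over the \<open>total\<close> incidences. The sum of squares is
    at most 2 D times \<open>total\<close>, so \<open>total\<close> comes out squared.\<close>
  have "(real C)\<^sup>2 = (\<Sum>x\<in>Sigma Q K. real (card (B (fst x) (snd x))))\<^sup>2"
    unfolding C_eq by (simp add: case_prod_beta)
  also have "\<dots> \<le> (\<Sum>x\<in>Sigma Q K. (real (card (B (fst x) (snd x))))\<^sup>2) * card (Sigma Q K)"
    by (rule sum_squared_le_sum_of_squares)
  also have "card (Sigma Q K) = total"
    unfolding total_def using finite_Q finite_K by (simp add: card_SigmaI)
  also have "(\<Sum>x\<in>Sigma Q K. (real (card (B (fst x) (snd x))))\<^sup>2)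
      = (\<Sum>a\<in>Q. \<Sum>v\<in>K a. (real (card (B a v)))\<^sup>2)"
    using finite_Q finite_K by (simp add: sum.Sigma case_prod_beta)
  also have "\<dots> \<le> (\<Sum>a\<in>Q. 2 * (D * card (K a)))"
  proof (rule sum_mono)
    fix a assume a: "a \<in> Q"
    have "(\<Sum>v\<in>K a. (card (B a v))\<^sup>2) \<le> (\<Sum>v\<in>K a. 2 * (\<Sum>b\<in>B a v. card (gap a b v)))"
      by (intro sum_mono square a)
    then have "real (\<Sum>v\<in>K a. (card (B a v))\<^sup>2) \<le> real (\<Sum>v\<in>K a. 2 * (\<Sum>b\<in>B a v. card (gap a b v)))"
      by (simp only: of_nat_le_iff)
    then show "(\<Sum>v\<in>K a. (real (card (B a v)))\<^sup>2) \<le> 2 * (D * card (K a))"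
      using gaps[OF a] by (simp flip: sum_distrib_left)
  qed
  also have "(\<Sum>a\<in>Q. 2 * (D * card (K a))) = 2 * D * total"
    unfolding total_def by (simp add: sum_distrib_left mult.assoc)
  finally have C2: "(real C)\<^sup>2 \<le> 2 * D * (real total)\<^sup>2"
    by (simp add: mult_right_mono power2_eq_square mult.assoc)
  then have "sqrt ((real C)\<^sup>2) \<le> sqrt (2 * D * (real total)\<^sup>2)" by (rule real_sqrt_le_mono)
  then have C: "real C \<le> total * sqrt (2 * D)" by (simp add: real_sqrt_mult mult_ac)
  have split: "card (K a \<inter> K b) = card (K a \<inter> K b - close a b) + card (close a b)" if "a \<in> Q" for a b
  proof -
    have "close a b \<subseteq> K a \<inter> K b" unfolding close_def by auto
    then show ?thesis
      using finite_K[OF that] by (metis card_Diff_subset card_mono finite_Int le_add_diff_inverse2 rev_finite_subset)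
  qed
  have "real crossings = (\<Sum>a\<in>Q. \<Sum>b\<in>Q - {a}. real (card (K a \<inter> K b - close a b))) + real C"
    unfolding crossings_def C_def using split by (simp add: sum.distrib)
  also have "(\<Sum>a\<in>Q. \<Sum>b\<in>Q - {a}. real (card (K a \<inter> K b - close a b)))
      \<le> (\<Sum>a\<in>Q. \<Sum>b\<in>Q - {a}. 1 + (len a + len b) / r)"
    using card_not_close_le by (intro sum_mono) auto
  also have "\<dots> \<le> (\<Sum>a\<in>Q. \<Sum>b\<in>Q. 1 + (len a + len b) / r)"
    using finite_Q by (intro sum_mono sum_mono2) auto
  finally show ?thesis using C by simp
qed

end

end

section \<open>Consistent path systems\<close>

text \<open>Consistency speaks only of paths that meet two vertices in the same order. Opposite
  orders stay unrestricted; they are left to the opposed families.\<close>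

locale path_system =
  fixes V :: "'a set" and P :: "'p set" and len :: "'p \<Rightarrow> nat" and pt :: "'p \<Rightarrow> nat \<Rightarrow> 'a"
  assumes finite_V: "finite V" and finite_P: "finite P"
    and pt_in_V: "\<lbrakk>a \<in> P; i \<le> len a\<rbrakk> \<Longrightarrow> pt a i \<in> V"
    and pt_inj: "a \<in> P \<Longrightarrow> inj_on (pt a) {..len a}"
    and consistent: "\<lbrakk>a \<in> P; b \<in> P; i < j; j \<le> len a; k < l; l \<le> len b; pt a i = pt b k; pt a j = pt b l\<rbrakk>
      \<Longrightarrow> j - i = l - k \<and> (\<forall>m\<le>j - i. pt a (i + m) = pt b (k + m))"
begin

definition pos :: "'p \<Rightarrow> 'a \<Rightarrow> nat" where "pos a = inv_into {..len a} (pt a)"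

lemma pos_pt [simp]: "\<lbrakk>a \<in> P; i \<le> len a\<rbrakk> \<Longrightarrow> pos a (pt a i) = i"
  unfolding pos_def using pt_inj by (simp add: inv_into_f_f)

text \<open>An arc is indexed by the position of its head, so the index sets used below avoid
  0.\<close>

definition arcs_to :: "'p set \<Rightarrow> ('p \<Rightarrow> nat set) \<Rightarrow> ('a \<times> 'a) set" where
  "arcs_to Q J = (\<lambda>(a, i). (pt a (i - 1), pt a i)) ` Sigma Q J"

text \<open>Each arc is charged to a single one of the paths that contain it. Two paths that
  traverse \<open>u\<close> and then \<open>v\<close> share the arc into \<open>v\<close>, so not both of them are charged at \<open>v\<close>.\<close>

lemma obtain_opposed_family:
  assumes Q: "Q \<subseteq> P" and J: "\<And>a. a \<in> Q \<Longrightarrow> J a \<subseteq> {1..len a}"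
  obtains K where "opposed_family V Q K pos" "\<forall>a\<in>Q. K a \<subseteq> pt a ` J a"
    "opposed_family.total Q K = card (arcs_to Q J)"
proof -
  define e where "e = (\<lambda>(a, i). (pt a (i - 1), pt a i))"
  \<comment> \<open>\<open>inv_into\<close> selects for each arc one path and one position on it;
    these pairs form the charging.\<close>
  define O1 where "O1 = inv_into (Sigma Q J) e ` arcs_to Q J"
  have arcs: "arcs_to Q J = e ` Sigma Q J" unfolding arcs_to_def e_def ..
  have O1_sub: "O1 \<subseteq> Sigma Q J" unfolding O1_def arcs by (intro image_subsetI inv_into_into)
  have inv: "e (inv_into (Sigma Q J) e x) = x" if "x \<in> arcs_to Q J" for x
    using that unfolding arcs by (rule f_inv_into_f)
  have O1_inj: "inj_on e O1"
  proof (rule inj_onI)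
    fix x y assume "x \<in> O1" "y \<in> O1" "e x = e y"
    then show "x = y" unfolding O1_def using inv by fastforce
  qed
  have O1_img: "e ` O1 = arcs_to Q J" unfolding O1_def image_image using inv by simp
  have fin_Q: "finite Q" using Q finite_P finite_subset by blast
  have fin_J: "finite (J a)" if "a \<in> Q" for a using J[OF that] finite_subset by blast
  define I where "I a = {i. (a, i) \<in> O1}" for a
  have I: "I a \<subseteq> J a" "I a \<subseteq> {1..len a}" if "a \<in> Q" for a
    using O1_sub J[OF that] that unfolding I_def by auto
  have O1_eq: "O1 = Sigma Q I" using O1_sub unfolding I_def by auto
  have I_inj: "inj_on (pt a) (I a)" if "a \<in> Q" for a
    using pt_inj I[OF that] Q that by (meson atMost_iff atLeastAtMost_iff inj_on_subset subset_iff)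
  have opp: "opposed_family V Q (\<lambda>a. pt a ` I a) pos"
  proof
    show "pt a ` I a \<subseteq> V" if "a \<in> Q" for a
      using I[OF that] that Q pt_in_V by (auto simp: subset_iff)
    show "inj_on (pos a) (pt a ` I a)" if "a \<in> Q" for a
    proof (rule inj_onI)
      fix x y assume "x \<in> pt a ` I a" "y \<in> pt a ` I a" "pos a x = pos a y"
      then show "x = y" using I[OF that] that Q by (auto simp: subset_iff)
    qed
    fix a b u v
    assume ab: "a \<in> Q" "b \<in> Q" "a \<noteq> b" and uv: "u \<in> pt a ` I a" "u \<in> pt b ` I b"
      "v \<in> pt a ` I a" "v \<in> pt b ` I b" and less: "pos a u < pos a v"
    have abP: "a \<in> P" "b \<in> P" using ab Q by auto
    obtain i j k l where ij: "i \<in> I a" "u = pt a i" "j \<in> I a" "v = pt a j"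
      "k \<in> I b" "u = pt b k" "l \<in> I b" "v = pt b l" using uv by blast
    have le: "i \<le> len a" "j \<le> len a" "k \<le> len b" "l \<le> len b" "1 \<le> j" "1 \<le> l"
      using I(2)[OF ab(1)] I(2)[OF ab(2)] ij by (auto simp: subset_iff)
    have pos: "pos a u = i" "pos b u = k" "pos a v = j" "pos b v = l"
      using abP le ij pos_pt by metis+
    have eq: "pt a i = pt b k" "pt a j = pt b l" using ij(2,4,6,8) by simp_all
    have "k \<noteq> l" using less ij(6,8) by auto
    moreover have "\<not> k < l"
    proof
      assume kl: "k < l"
      have ijl: "i < j" using less pos by simp
      have c: "j - i = l - k" "\<forall>m\<le>j - i. pt a (i + m) = pt b (k + m)"
        using consistent[OF abP ijl le(2) kl le(4) eq] by blast+
      have "pt a (i + (j - i - 1)) = pt b (k + (j - i - 1))" using c(2) by simp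
      moreover have "i + (j - i - 1) = j - 1" "k + (j - i - 1) = l - 1" using c(1) ijl kl by auto
      ultimately have "pt a (j - 1) = pt b (l - 1)" by simp
      then have "e (a, j) = e (b, l)" unfolding e_def using eq by simp
      moreover have "(a, j) \<in> O1" "(b, l) \<in> O1" using ij(3,7) unfolding I_def by auto
      ultimately show False using O1_inj ab(3) by (auto dest: inj_onD)
    qed
    ultimately show "pos b v < pos b u" using pos by simp
  qed (use finite_V fin_Q in auto)
  moreover have "\<forall>a\<in>Q. (\<lambda>a. pt a ` I a) a \<subseteq> pt a ` J a" using I(1) by auto
  moreover have "opposed_family.total Q (\<lambda>a. pt a ` I a) = card (arcs_to Q J)"
  proof -
    have "opposed_family.total Q (\<lambda>a. pt a ` I a) = (\<Sum>a\<in>Q. card (I a))"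
      unfolding opposed_family.total_def[OF opp] using I_inj by (simp add: card_image)
    also have "\<dots> = card O1"
      unfolding O1_eq using fin_Q I(1) fin_J by (metis card_SigmaI finite_subset)
    also have "\<dots> = card (arcs_to Q J)" using O1_inj O1_img card_image by fastforce
    finally show ?thesis .
  qed
  ultimately show thesis by (rule that)
qed

section \<open>Arcs of a union of paths\<close>

definition path_arcs :: "'p set \<Rightarrow> ('a \<times> 'a) set" where
  "path_arcs Q = (\<Union>a\<in>Q. (\<lambda>i. (pt a i, pt a (Suc i))) ` {..<len a})"

lemma path_arcs_eq: "path_arcs Q = arcs_to Q (\<lambda>a. {1..len a})"
proof -
  have "(\<lambda>i. (pt a i, pt a (Suc i))) ` {..<len a} = (\<lambda>i. (pt a (i - 1), pt a i)) ` {1..len a}" for a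
  proof -
    have "{1..len a} = Suc ` {..<len a}"
      by (simp add: image_Suc_lessThan)
    then show ?thesis by (simp add: image_image)
  qed
  then show ?thesis unfolding path_arcs_def arcs_to_def by (auto simp: Sigma_def)
qed

lemma path_arcs_Un: "path_arcs (Q \<union> R) = path_arcs Q \<union> path_arcs R"
  unfolding path_arcs_def by auto

lemma path_arcs_family:
  assumes "Q \<subseteq> P"
  obtains K where "opposed_family V Q K pos" "\<forall>a\<in>Q. K a \<subseteq> pt a ` {1..len a}"
    "opposed_family.total Q K = card (path_arcs Q)"
proof (rule obtain_opposed_family[OF assms, of "\<lambda>a. {1..len a}"])
  fix K assume "opposed_family V Q K pos" "\<forall>a\<in>Q. K a \<subseteq> pt a ` {1..len a}"
    "opposed_family.total Q K = card (arcs_to Q (\<lambda>a. {1..len a}))"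
  then show thesis unfolding path_arcs_eq[symmetric] by (rule that)
qed auto

lemma card_path_arcs_le_pairs:
  assumes "Q \<subseteq> P"
  shows "real (card (path_arcs Q)) \<le> 2 * card Q + 2 * card V * sqrt (card Q)"
proof -
  obtain K where K: "opposed_family V Q K pos" "\<forall>a\<in>Q. K a \<subseteq> pt a ` {1..len a}"
    "opposed_family.total Q K = card (path_arcs Q)"
    by (rule path_arcs_family[OF assms]) (rule that)
  show ?thesis using opposed_family.total_le_pairs[OF K(1)] K(3) by simp
qed

lemma card_path_arcs_le_triples:
  assumes "Q \<subseteq> P"
  shows "real (card (path_arcs Q)) \<le> 15 * real (card V) + 3 * root 3 (card V) ^ 2 * real (card Q)"
proof -
  obtain K where K: "opposed_family V Q K pos" "\<forall>a\<in>Q. K a \<subseteq> pt a ` {1..len a}"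
    "opposed_family.total Q K = card (path_arcs Q)"
    by (rule path_arcs_family[OF assms]) (rule that)
  show ?thesis using opposed_family.total_le_triple[OF K(1)] K(3) by simp
qed

text \<open>Consistency is symmetric under reversal. Thus a bound for the parts of paths that leave
  a hub also serves the parts that approach it.\<close>

lemma path_system_reverse: "path_system V P len (\<lambda>a i. pt a (len a - i))"
proof
  show "inj_on (\<lambda>i. pt a (len a - i)) {..len a}" if "a \<in> P" for a
  proof (rule inj_onI)
    fix x y assume xy: "x \<in> {..len a}" "y \<in> {..len a}" "pt a (len a - x) = pt a (len a - y)"
    then have "len a - x = len a - y" using pt_inj[OF that] by (auto dest: inj_onD)
    then show "x = y" using xy by auto
  qed
  fix a b i j k l
  assume A: "a \<in> P" "b \<in> P" "i < j" "j \<le> len a" "k < l" "l \<le> len b"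
    "pt a (len a - i) = pt b (len b - k)" "pt a (len a - j) = pt b (len b - l)"
  have c: "(len a - i) - (len a - j) = (len b - k) - (len b - l) \<and>
     (\<forall>m\<le>(len a - i) - (len a - j). pt a (len a - j + m) = pt b (len b - l + m))"
    using A by (intro consistent) auto
  moreover have d: "(len a - i) - (len a - j) = j - i" "(len b - k) - (len b - l) = l - k"
    using A by auto
  moreover have "pt a (len a - (i + m)) = pt b (len b - (k + m))" if "m \<le> j - i" for m
  proof -
    have "j - i - m \<le> (len a - i) - (len a - j)" using d by simp
    then have "pt a (len a - j + (j - i - m)) = pt b (len b - l + (j - i - m))" using c by blast
    moreover have "len a - j + (j - i - m) = len a - (i + m)" using that A by simp
    moreover have "len b - l + (j - i - m) = len b - (k + m)" using that A c d by simp
    ultimately show ?thesis by simp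
  qed
  ultimately show "j - i = l - k \<and> (\<forall>m\<le>j - i. pt a (len a - (i + m)) = pt b (len b - (k + m)))"
    by simp
qed (use finite_V finite_P pt_in_V in auto)

section \<open>Paths that pass near a common hub\<close>

definition records :: "('a \<Rightarrow> nat) \<Rightarrow> ('p \<Rightarrow> nat) \<Rightarrow> 'p \<Rightarrow> nat set" where
  "records f st a = {i. st a < i \<and> i \<le> len a \<and> (\<forall>k. st a \<le> k \<and> k < i \<longrightarrow> f (pt a k) < f (pt a i))}"

text \<open>Records are the strict left-to-right maxima of \<open>f\<close> from position
  \<open>st a\<close> on. The running maximum grows by at most one at a time, and only at records.
  It rises from at most \<open>R\<close> to at least \<open>len a - st a - R\<close>, so all but
  \<open>2 * R\<close> positions are records.\<close>

lemma card_nonrecords: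
  assumes step: "\<And>i. \<lbrakk>st a \<le> i; i < len a\<rbrakk> \<Longrightarrow> f (pt a (Suc i)) \<le> f (pt a i) + 1"
    and start: "st a \<le> len a" "f (pt a (st a)) \<le> R" and final: "len a \<le> st a + R + f (pt a (len a))"
  shows "card ({st a<..len a} - records f st a) \<le> 2 * R"
proof -
  have bound: "f (pt a k) \<le> f (pt a (st a)) + card (records f st a \<inter> {..j})"
    if "st a \<le> j" "j \<le> len a" "st a \<le> k" "k \<le> j" for j k
    using that
  proof (induction j arbitrary: k rule: dec_induct)
    case base
    then show ?case by simp
  next
    case (step j)
    have fin: "finite (records f st a \<inter> {..Suc j})" by auto
    have mono: "card (records f st a \<inter> {..j}) \<le> card (records f st a \<inter> {..Suc j})"
      using fin by (intro card_mono) auto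
    show ?case
    proof (cases "k = Suc j")
      case False
      then show ?thesis using step mono by (meson Suc_leD add_left_mono le_SucE le_trans)
    next
      case True
      show ?thesis
      proof (cases "Suc j \<in> records f st a")
        case True
        then have "records f st a \<inter> {..Suc j} = insert (Suc j) (records f st a \<inter> {..j})"
          by (auto simp: atMost_Suc)
        then have "card (records f st a \<inter> {..Suc j}) = card (records f st a \<inter> {..j}) + 1" by simp
        moreover have "f (pt a j) \<le> f (pt a (st a)) + card (records f st a \<inter> {..j})"
          using step.IH[of j] step.hyps step.prems by linarith
        ultimately show ?thesis
          unfolding \<open>k = Suc j\<close> using assms(1)[of j] step.hyps step.prems by linarith
      next
        case False
        then obtain k' where k': "st a \<le> k'" "k' \<le> j" "f (pt a (Suc j)) \<le> f (pt a k')"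
          using step unfolding records_def by (auto simp: not_less less_Suc_eq_le)
        then show ?thesis
          unfolding \<open>k = Suc j\<close> using step.IH[of k'] step.hyps step.prems mono by linarith
      qed
    qed
  qed
  have sub: "records f st a \<subseteq> {st a<..len a}" unfolding records_def by auto
  have "f (pt a (len a)) \<le> R + card (records f st a \<inter> {..len a})"
    using bound[of "len a" "len a"] start by simp
  also have "records f st a \<inter> {..len a} = records f st a" using sub by auto
  finally have "f (pt a (len a)) \<le> R + card (records f st a)" .
  moreover have "card ({st a<..len a} - records f st a) = (len a - st a) - card (records f st a)"
    using sub finite_subset[OF sub] by (simp add: card_Diff_subset)
  ultimately show ?thesis using final by linarith
qed

text \<open>If two paths, both starting near a hub, reach \<open>u\<close> and \<open>v\<close> in opposite orders, the distances
  from the hub cannot set a new maximum at the later vertex on both paths. Hence paths that are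
  charged only at their records have at most one vertex in common.\<close>

lemma card_arcs_after_le:
  assumes Q: "Q \<subseteq> P"
    and step: "\<And>a i. \<lbrakk>a \<in> Q; st a \<le> i; i < len a\<rbrakk> \<Longrightarrow> f (pt a (Suc i)) \<le> f (pt a i) + 1"
    and start: "\<And>a. a \<in> Q \<Longrightarrow> st a \<le> len a" "\<And>a. a \<in> Q \<Longrightarrow> f (pt a (st a)) \<le> R"
    and final: "\<And>a. a \<in> Q \<Longrightarrow> len a \<le> st a + R + f (pt a (len a))"
  shows "real (card (arcs_to Q (\<lambda>a. {st a<..len a}))) \<le> card V + sqrt (card V) * card Q + 2 * real R * card Q"
proof -
  have fin_Q: "finite Q" using Q finite_P finite_subset by blast
  have rec_sub: "records f st a \<subseteq> {1..len a}" for a unfolding records_def by auto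
  obtain K where K: "opposed_family V Q K pos" "\<forall>a\<in>Q. K a \<subseteq> pt a ` records f st a"
    "opposed_family.total Q K = card (arcs_to Q (records f st))"
    by (rule obtain_opposed_family[OF Q rec_sub]) (rule that)
  have increasing: "f u < f v"
    if a: "a \<in> Q" and uv: "u \<in> K a" "v \<in> K a" "pos a u < pos a v" for a u v
  proof -
    obtain i j where ij: "i \<in> records f st a" "u = pt a i" "j \<in> records f st a" "v = pt a j"
      using K(2)[rule_format, OF a] uv by blast
    then have "pos a u = i" "pos a v = j" 
      using rec_sub[of a] subsetD[OF Q a] by (auto intro!: pos_pt)
    then show ?thesis using ij uv unfolding records_def by simp
  qed
  have "card (K a \<inter> K b) \<le> 1" if ab: "a \<in> Q" "b \<in> Q" "a \<noteq> b" for a b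
  proof -
    have *: False if "u \<in> K a \<inter> K b" "v \<in> K a \<inter> K b" "pos a u < pos a v" for u v
      using increasing[of a u v] increasing[of b v u] opposed_family.opposed[OF K(1) ab, of u v] that ab
      by auto
    have "u = v" if "u \<in> K a \<inter> K b" "v \<in> K a \<inter> K b" for u v
    proof -
      have "pos a u = pos a v" using *[of u v] *[of v u] that by (meson linorder_neqE_nat)
      then show ?thesis using opposed_family.pos_inj[OF K(1) ab(1)] that by (auto dest: inj_onD)
    qed
    moreover have "finite (K a)" using opposed_family.finite_K[OF K(1) ab(1)] .
    ultimately show ?thesis by (simp add: card_le_Suc0_iff_eq)
  qed
  then have rec: "real (card (arcs_to Q (records f st))) \<le> card V + sqrt (card V) * card Q"
    using opposed_family.total_le_single_crossing[OF K(1)] K(3) by simp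
  \<comment> \<open>Arcs into positions that are not records are counted one by one, at most
    \<open>2 * R\<close> per path.\<close>
  let ?N = "\<lambda>a. {st a<..len a} - records f st a"
  have "card (arcs_to Q ?N) \<le> card (Sigma Q ?N)"
    unfolding arcs_to_def using fin_Q by (intro card_image_le) auto
  also have "\<dots> = (\<Sum>a\<in>Q. card (?N a))" using fin_Q by (simp add: card_SigmaI)
  also have "\<dots> \<le> (\<Sum>a\<in>Q. 2 * R)"
    by (intro sum_mono card_nonrecords) (use step start final in auto)
  finally have "real (card (arcs_to Q ?N)) \<le> real (\<Sum>a\<in>Q. 2 * R)" by (simp only: of_nat_le_iff)
  then have non: "real (card (arcs_to Q ?N)) \<le> 2 * real R * card Q" by (simp add: mult_ac)
  have "arcs_to Q (\<lambda>a. {st a<..len a}) \<subseteq> arcs_to Q (records f st) \<union> arcs_to Q ?N"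
    unfolding arcs_to_def by auto
  moreover have "finite (records f st a)" for a using rec_sub finite_subset by blast
  then have "finite (arcs_to Q (records f st) \<union> arcs_to Q ?N)"
    unfolding arcs_to_def using fin_Q by auto
  ultimately have "card (arcs_to Q (\<lambda>a. {st a<..len a})) \<le> card (arcs_to Q (records f st)) + card (arcs_to Q ?N)"
    by (meson card_Un_le card_mono le_trans)
  then have "real (card (arcs_to Q (\<lambda>a. {st a<..len a}))) \<le> real (card (arcs_to Q (records f st)) + card (arcs_to Q ?N))"
    by (simp only: of_nat_le_iff)
  then show ?thesis using rec non by simp
qed

text \<open>Each path is cut at \<open>st a\<close>, where it comes near the hub. Distances
  \<open>f\<close> from the hub control the part after the cut; for the part before it the paths are
  reversed and distances \<open>g\<close> to the hub take over.\<close>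

lemma card_path_arcs_le_hub:
  assumes Q: "Q \<subseteq> P" and st: "\<And>a. a \<in> Q \<Longrightarrow> st a \<le> len a"
    and f: "\<And>a i. \<lbrakk>a \<in> Q; st a \<le> i; i < len a\<rbrakk> \<Longrightarrow> f (pt a (Suc i)) \<le> f (pt a i) + 1"
      "\<And>a. a \<in> Q \<Longrightarrow> f (pt a (st a)) \<le> R" "\<And>a. a \<in> Q \<Longrightarrow> len a \<le> st a + R + f (pt a (len a))"
    and g: "\<And>a i. \<lbrakk>a \<in> Q; i < st a\<rbrakk> \<Longrightarrow> g (pt a i) \<le> g (pt a (Suc i)) + 1"
      "\<And>a. a \<in> Q \<Longrightarrow> g (pt a (st a)) \<le> R" "\<And>a. a \<in> Q \<Longrightarrow> st a \<le> R + g (pt a 0)"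
  shows "real (card (path_arcs Q)) \<le> 2 * card V + (2 * sqrt (card V) + 4 * real R) * card Q"
proof -
  interpret rev: path_system V P len "\<lambda>a i. pt a (len a - i)" by (rule path_system_reverse)
  have fin_Q: "finite Q" using Q finite_P finite_subset by blast
  let ?A = "arcs_to Q (\<lambda>a. {st a<..len a})"
  let ?B = "rev.arcs_to Q (\<lambda>a. {len a - st a<..len a})"
  have A: "real (card ?A) \<le> card V + sqrt (card V) * card Q + 2 * real R * card Q"
    by (rule card_arcs_after_le[OF Q, where f = f]) (use st f in auto)
  have B: "real (card ?B) \<le> card V + sqrt (card V) * card Q + 2 * real R * card Q"
  proof (rule rev.card_arcs_after_le[OF Q, where f = g])
    fix a i assume a: "a \<in> Q" "len a - st a \<le> i" "i < len a"
    then show "g (pt a (len a - Suc i)) \<le> g (pt a (len a - i)) + 1"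
      using g(1)[of a "len a - Suc i"] st[of a] by (simp add: Suc_diff_Suc)
  next
    fix a assume a: "a \<in> Q"
    show "len a \<le> len a - st a + R + g (pt a (len a - len a))"
      using g(3)[OF a] st[OF a] by simp
  qed (use st g in auto)
  \<comment> \<open>Reversed paths traverse their arcs backwards, hence the converse of
    \<open>?B\<close>.\<close>
  have "path_arcs Q \<subseteq> ?A \<union> ?B\<inverse>"
  proof
    fix x assume "x \<in> path_arcs Q"
    then obtain a i where a: "a \<in> Q" "i < len a" "x = (pt a i, pt a (Suc i))"
      unfolding path_arcs_def by blast
    show "x \<in> ?A \<union> ?B\<inverse>"
    proof (cases "st a \<le> i")
      case True
      then have "(a, Suc i) \<in> (SIGMA a:Q. {st a<..len a})" using a by auto
      then have "x \<in> ?A" unfolding arcs_to_def a(3) by force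
      then show ?thesis ..
    next
      case False
      then have "(a, len a - i) \<in> (SIGMA a:Q. {len a - st a<..len a})" using a st[OF a(1)] by auto
      moreover have "len a - (len a - i - 1) = Suc i" "len a - (len a - i) = i" using a by auto
      ultimately have "(pt a (Suc i), pt a i) \<in> ?B" unfolding rev.arcs_to_def by force
      then show ?thesis unfolding a(3) by auto
    qed
  qed
  moreover have "finite ?A" "finite (?B\<inverse>)"
    unfolding arcs_to_def rev.arcs_to_def using fin_Q by auto
  ultimately have "card (path_arcs Q) \<le> card ?A + card (?B\<inverse>)"
    by (meson card_Un_le card_mono finite_UnI le_trans)
  then have "real (card (path_arcs Q)) \<le> real (card ?A + card ?B)" by (simp only: of_nat_le_iff card_inverse)
  then show ?thesis using A B by (simp add: algebra_simps)
qed

section \<open>Systems without hubs, and the greedy removal of hubs\<close>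

lemma card_path_arcs_light:
  fixes D :: real and r :: nat
  assumes Q: "Q \<subseteq> P" and r: "r > 0"
    and on: "\<And>a i. \<lbrakk>a \<in> Q; i \<le> len a\<rbrakk> \<Longrightarrow> near (pt a i) a"
    and round_trip: "\<And>a b i j k l m. \<lbrakk>a \<in> Q; b \<in> Q; i < m; m \<le> j; j \<le> len a; k < l; l \<le> len b;
      pt a i = pt b l; pt a j = pt b k; (j - i) + (l - k) \<le> r\<rbrakk> \<Longrightarrow> near (pt a m) b"
    and light: "\<And>z. z \<in> V \<Longrightarrow> real (card {b\<in>Q. near z b}) \<le> D"
  shows "(real (card (path_arcs Q)))\<^sup>2 \<le> card V * (card (path_arcs Q) * (1 + sqrt (2 * D))
    + (real (card Q))\<^sup>2 + 2 * card Q * card V * D / r)"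
proof -
  have fin_Q: "finite Q" using Q finite_P finite_subset by blast
  obtain K where K: "opposed_family V Q K pos" "\<forall>a\<in>Q. K a \<subseteq> pt a ` {1..len a}"
    "opposed_family.total Q K = card (path_arcs Q)"
    by (rule path_arcs_family[OF Q]) (rule that)
  interpret fam: opposed_family V Q K pos by (rule K(1))
  have pos: "pos a v \<le> len a" "pt a (pos a v) = v" if a: "a \<in> Q" "v \<in> K a" for a v
  proof -
    obtain i where "v = pt a i" "i \<le> len a" using K(2)[rule_format, OF a(1)] a(2) by auto
    then show "pos a v \<le> len a" "pt a (pos a v) = v" using pos_pt[OF subsetD[OF Q a(1)]] by auto
  qed
  have near_K: "near z b" if ab: "a \<in> Q" "b \<in> Q" "a \<noteq> b" and v: "v \<in> K a \<inter> K b"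
    and u: "u \<in> K a \<inter> K b" and z: "z \<in> K a" "pos a v < pos a z" "pos a z \<le> pos a u"
    and r: "pos a u - pos a v + (pos b v - pos b u) \<le> r" for a b v u z
  proof -
    have vu: "v \<in> K a" "v \<in> K b" "u \<in> K a" "u \<in> K b" using v u by auto
    have "pos a v < pos a u" using z by simp
    then have "pos b u < pos b v" using fam.opposed[OF ab] vu by blast
    then have "near (pt a (pos a z)) b"
      using round_trip[OF ab(1,2) z(2,3) pos(1)[OF ab(1) vu(3)] _ pos(1)[OF ab(2) vu(2)] _ _ r]
        pos(2)[OF ab(1)] pos(2)[OF ab(2)] vu by metis
    then show ?thesis using pos(2)[OF ab(1) z(1)] by simp
  qed
  \<comment> \<open>A path is near each of its own vertices, so lightness puts at most
    \<open>D\<close> paths on a vertex. Double counting bounds the sum of all lengths by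
    \<open>card V * D\<close>.\<close>
  have "real (\<Sum>a\<in>Q. len a) \<le> real (\<Sum>a\<in>Q. card (pt a ` {..len a}))"
    using pt_inj Q by (intro of_nat_mono sum_mono) (auto simp: card_image)
  also have "(\<Sum>a\<in>Q. card (pt a ` {..len a})) = (\<Sum>a\<in>Q. \<Sum>z | z \<in> V \<and> z \<in> pt a ` {..len a}. 1)"
    using pt_in_V Q by (intro sum.cong) (auto intro!: arg_cong[where f = card])
  also have "\<dots> = (\<Sum>z\<in>V. \<Sum>a | a \<in> Q \<and> z \<in> pt a ` {..len a}. 1)"
    by (rule sum.swap_restrict) (use finite_V fin_Q in auto)
  also have "\<dots> \<le> (\<Sum>z\<in>V. card {b\<in>Q. near z b})"
    unfolding card_eq_sum[symmetric] using fin_Q on by (intro sum_mono card_mono) auto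
  also have "real \<dots> \<le> (\<Sum>z\<in>V. D)"
    unfolding of_nat_sum using light by (intro sum_mono)
  finally have len: "(\<Sum>a\<in>Q. real (len a)) \<le> card V * D" by (simp add: sum_mono)
  have "(\<Sum>a\<in>Q. \<Sum>b\<in>Q. 1 + (real (len a) + real (len b)) / r)
      = (real (card Q))\<^sup>2 + 2 * card Q * (\<Sum>a\<in>Q. real (len a)) / r"
    by (simp add: sum.distrib add_divide_distrib power2_eq_square algebra_simps
        flip: sum_divide_distrib sum_distrib_left)
  also have "\<dots> \<le> (real (card Q))\<^sup>2 + 2 * card Q * (card V * D) / r"
    using len r by (intro add_left_mono divide_right_mono mult_left_mono) auto
  finally have 1: "(\<Sum>a\<in>Q. \<Sum>b\<in>Q. 1 + (real (len a) + real (len b)) / r)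
      \<le> (real (card Q))\<^sup>2 + 2 * card Q * card V * D / r" by (simp add: mult_ac)
  have "real fam.crossings \<le> (\<Sum>a\<in>Q. \<Sum>b\<in>Q. 1 + real (len a + len b) / r) + fam.total * sqrt (2 * D)"
    by (rule fam.crossings_le[where near = near, OF pos(1) near_K r light])
  with 1 have 2: "real fam.crossings \<le> (real (card Q))\<^sup>2 + 2 * card Q * card V * D / r + fam.total * sqrt (2 * D)"
    by simp
  have "real (fam.total\<^sup>2) \<le> real (card V * (fam.total + fam.crossings))"
    using fam.total_square_le by (simp only: of_nat_le_iff)
  also have "\<dots> = card V * (real fam.total + real fam.crossings)" by simp
  also have "\<dots> \<le> card V * (fam.total + ((real (card Q))\<^sup>2 + 2 * card Q * card V * D / r + fam.total * sqrt (2 * D)))"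
    using 2 by (intro mult_left_mono) auto
  finally show ?thesis unfolding K(3) by (simp add: algebra_simps)
qed

text \<open>While some vertex of \<open>V\<close> is near more than \<open>D\<close> paths, all
  paths near it are removed at once. Spread over more than \<open>D\<close> paths, the fixed cost
  \<alpha> is at most \<alpha> / D for each. What remains is light and costs at most
  \<open>B\<close>.\<close>

lemma card_path_arcs_greedy:
  fixes D \<alpha> \<beta> B :: real
  assumes "Q \<subseteq> P" and nonneg: "D > 0" "\<alpha> \<ge> 0" "\<beta> \<ge> 0" "B \<ge> 0"
    and hub: "\<And>Q z. Q \<subseteq> P \<Longrightarrow> \<forall>a\<in>Q. near z a \<Longrightarrow> real (card (path_arcs Q)) \<le> \<alpha> + \<beta> * card Q"
    and light: "\<And>Q. Q \<subseteq> P \<Longrightarrow> \<forall>z\<in>V. real (card {a\<in>Q. near z a}) \<le> D \<Longrightarrow> real (card (path_arcs Q)) \<le> B"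
  shows "real (card (path_arcs Q)) \<le> card Q * (\<alpha> / D + \<beta>) + B"
  using assms(1)
proof (induction "card Q" arbitrary: Q rule: less_induct)
  case less
  have fin: "finite Q" using less.prems finite_P finite_subset by blast
  show ?case
  proof (cases "\<forall>z\<in>V. real (card {a\<in>Q. near z a}) \<le> D")
    case True
    have "0 \<le> card Q * (\<alpha> / D + \<beta>)" using nonneg by simp
    then show ?thesis using light[OF less.prems True] by linarith
  next
    case False
    then obtain z where z: "real (card {a\<in>Q. near z a}) > D" by (meson not_le)
    define S where "S = {a\<in>Q. near z a}"
    have S: "S \<subseteq> Q" "card S > D" using z unfolding S_def by auto
    then have pos: "card S > 0" using nonneg by (metis linorder_neqE_nat not_less0 of_nat_0 order_less_asym)
    have cards: "card Q = card (Q - S) + card S"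
      using S fin by (metis card_Diff_subset card_mono finite_subset le_add_diff_inverse2)
    have "path_arcs Q = path_arcs S \<union> path_arcs (Q - S)"
      using S by (metis Un_Diff_cancel path_arcs_Un sup.absorb2)
    then have "card (path_arcs Q) \<le> card (path_arcs S) + card (path_arcs (Q - S))"
      by (simp add: card_Un_le)
    then have "real (card (path_arcs Q)) \<le> real (card (path_arcs S) + card (path_arcs (Q - S)))"
      by (simp only: of_nat_le_iff)
    then have 1: "real (card (path_arcs Q)) \<le> real (card (path_arcs S)) + real (card (path_arcs (Q - S)))"
      by simp
    have SP: "S \<subseteq> P" "\<forall>a\<in>S. near z a" using S(1) less.prems unfolding S_def by blast+
    have 2: "real (card (path_arcs S)) \<le> \<alpha> + \<beta> * card S" by (rule hub[OF SP])
    have "D * (\<alpha> / D) \<le> card S * (\<alpha> / D)" using S nonneg by (intro mult_right_mono) auto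
    then have 3: "\<alpha> \<le> card S * (\<alpha> / D)" using nonneg by simp
    have "card (Q - S) < card Q" "Q - S \<subseteq> P" using cards pos less.prems by auto
    then have 4: "real (card (path_arcs (Q - S))) \<le> card (Q - S) * (\<alpha> / D + \<beta>) + B"
      by (rule less.hyps)
    show ?thesis using 1 2 3 4 unfolding cards by (simp add: algebra_simps)
  qed
qed

end

section \<open>Canonical shortest paths\<close>

text \<open>For unreachable pairs \<open>LEAST\<close> yields an unspecified number, so statements
  about distances carry reachability along.\<close>

definition gdist :: "('a \<times> 'a) set \<Rightarrow> 'a \<Rightarrow> 'a \<Rightarrow> nat" where
  "gdist E u v = (LEAST k. (u, v) \<in> E ^^ k)"

lemma gdist_relpow: "(u, v) \<in> E\<^sup>* \<Longrightarrow> (u, v) \<in> E ^^ gdist E u v"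
  unfolding gdist_def rtrancl_power by (erule LeastI_ex)

lemma gdist_le: "(u, v) \<in> E ^^ k \<Longrightarrow> gdist E u v \<le> k"
  unfolding gdist_def by (rule Least_le)

lemma gdist_self [simp]: "gdist E u u = 0"
  using gdist_le[of u u 0 E] by simp

lemma gdist_eq_0D: "\<lbrakk>(u, v) \<in> E\<^sup>*; gdist E u v = 0\<rbrakk> \<Longrightarrow> u = v"
  using gdist_relpow[of u v E] by simp

lemma gdist_triangle:
  assumes "(u, v) \<in> E\<^sup>*" "(v, w) \<in> E\<^sup>*"
  shows "gdist E u w \<le> gdist E u v + gdist E v w"
  using gdist_relpow[OF assms(1)] gdist_relpow[OF assms(2)]
  by (intro gdist_le) (auto simp: relpow_add)

lemma gdist_arc: "(u, v) \<in> E \<Longrightarrow> gdist E u v \<le> 1"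
  by (rule gdist_le) simp

lemma relpow_mono:
  fixes E F :: "('a \<times> 'a) set"
  shows "F \<subseteq> E \<Longrightarrow> F ^^ k \<subseteq> E ^^ k"
  by (induction k) (auto intro: relcompI)

section \<open>Shortest paths with ties broken by labels\<close>

locale labelled_digraph =
  fixes V :: "'a set" and E :: "('a \<times> 'a) set" and label :: "'a \<Rightarrow> nat"
  assumes finite_V: "finite V" and E_subset: "E \<subseteq> V \<times> V" and label_inj: "inj_on label V"
begin

text \<open>These \<open>x\<close> are the possible second vertices of a shortest walk from
  \<open>u\<close> to \<open>v\<close>.\<close>

definition forward :: "'a \<Rightarrow> 'a \<Rightarrow> 'a \<Rightarrow> bool" where
  "forward u v x \<longleftrightarrow> (u, x) \<in> E \<and> (x, v) \<in> E\<^sup>* \<and> gdist E u v = Suc (gdist E x v)"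

text \<open>Breaking ties by the label makes subpaths of canonical shortest paths canonical.\<close>

definition hop :: "'a \<Rightarrow> 'a \<Rightarrow> 'a" where
  "hop u v = arg_min label (forward u v)"

definition spath :: "'a \<times> 'a \<Rightarrow> nat \<Rightarrow> 'a" where
  "spath a i = ((\<lambda>x. hop x (snd a)) ^^ i) (fst a)"

definition slen :: "'a \<times> 'a \<Rightarrow> nat" where
  "slen a = gdist E (fst a) (snd a)"

lemma spath_0 [simp]: "spath a 0 = fst a"
  and spath_Suc [simp]: "spath a (Suc i) = hop (spath a i) (snd a)"
  unfolding spath_def by auto

lemma forward_hop:
  assumes "(u, v) \<in> E\<^sup>*" "u \<noteq> v"
  shows "forward u v (hop u v)"
proof -
  have "gdist E u v \<noteq> 0" using assms gdist_eq_0D by fast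
  then obtain k where k: "gdist E u v = Suc k" using not0_implies_Suc by blast
  then obtain x where x: "(u, x) \<in> E" "(x, v) \<in> E ^^ k"
    using gdist_relpow[OF assms(1)] by (metis relpow_Suc_E2)
  have xv: "(x, v) \<in> E\<^sup>*" using x(2) by (rule relpow_imp_rtrancl)
  have "gdist E u v \<le> gdist E u x + gdist E x v" using x xv by (intro gdist_triangle) auto
  then have "gdist E x v = k" using gdist_le[OF x(2)] gdist_arc[OF x(1)] k by linarith
  then have "forward u v x" unfolding forward_def using x xv k by simp
  then show ?thesis unfolding hop_def by (rule arg_min_natI)
qed

context
  fixes a :: "'a \<times> 'a" assumes a: "a \<in> E\<^sup>*"
begin

lemma spath_to_target:
  "i \<le> slen a \<Longrightarrow> (spath a i, snd a) \<in> E\<^sup>* \<and> gdist E (spath a i) (snd a) = slen a - i"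
proof (induction i)
  case 0
  then show ?case using a by (simp add: slen_def)
next
  case (Suc i)
  then have IH: "(spath a i, snd a) \<in> E\<^sup>*" "gdist E (spath a i) (snd a) = slen a - i" by auto
  then have "spath a i \<noteq> snd a" using Suc.prems by auto
  from forward_hop[OF IH(1) this] show ?case using IH(2) by (auto simp: forward_def)
qed

lemma forward_spath: "i < slen a \<Longrightarrow> forward (spath a i) (snd a) (spath a (Suc i))"
  using spath_to_target[of i] forward_hop[of "spath a i" "snd a"]
  by (cases "spath a i = snd a") auto

lemma spath_arc: "i < slen a \<Longrightarrow> (spath a i, spath a (Suc i)) \<in> E"
  using forward_spath unfolding forward_def by blast

lemma spath_end: "spath a (slen a) = snd a"
  using spath_to_target[of "slen a"] by (auto intro: gdist_eq_0D)

lemma spath_relpow: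
  assumes "\<And>i. i < slen a \<Longrightarrow> (spath a i, spath a (Suc i)) \<in> F" "i + k \<le> slen a"
  shows "(spath a i, spath a (i + k)) \<in> F ^^ k"
  using assms(2)
proof (induction k)
  case (Suc k)
  then show ?case using assms(1)[of "i + k"] by auto
qed auto

lemma spath_reach: "\<lbrakk>i \<le> j; j \<le> slen a\<rbrakk> \<Longrightarrow> (spath a i, spath a j) \<in> E\<^sup>*"
  using spath_relpow[OF spath_arc, of i "j - i"] by (auto dest: relpow_imp_rtrancl)

lemma gdist_spath:
  assumes "i \<le> j" "j \<le> slen a"
  shows "gdist E (spath a i) (spath a j) = j - i"
proof -
  have "gdist E (spath a i) (spath a j) \<le> j - i"
    using spath_relpow[OF spath_arc, of i "j - i"] assms by (intro gdist_le) auto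
  moreover have "gdist E (spath a i) (snd a) \<le> gdist E (spath a i) (spath a j) + gdist E (spath a j) (snd a)"
    using spath_reach[OF assms] spath_to_target[OF assms(2)] by (intro gdist_triangle) auto
  ultimately show ?thesis using spath_to_target[of i] spath_to_target[of j] assms by auto
qed

text \<open>Every candidate for the next vertex towards \<open>spath a j\<close> is also one towards
  the target of \<open>a\<close>. The vertex chosen for the target has the least label in the larger
  set and lies in the smaller one, so it is chosen there too.\<close>

lemma hop_eq_hop_subpath:
  assumes "i < j" "j \<le> slen a"
  shows "hop (spath a i) (spath a j) = spath a (Suc i)"
proof -
  let ?x = "spath a i" and ?y = "spath a (Suc i)" and ?v = "spath a j" and ?t = "snd a"
  have xv: "(?x, ?v) \<in> E\<^sup>*" "gdist E ?x ?v = j - i"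
    using spath_reach[of i j] gdist_spath[of i j] assms by auto
  have vt: "(?v, ?t) \<in> E\<^sup>*" "gdist E ?v ?t = slen a - j" "gdist E ?x ?t = slen a - i" "(?x, ?t) \<in> E\<^sup>*"
    using spath_to_target[of j] spath_to_target[of i] assms by auto
  have y: "forward ?x ?v ?y"
    unfolding forward_def using spath_arc[of i] spath_reach[of "Suc i" j] gdist_spath[of "Suc i" j] xv assms
    by (auto simp del: spath_Suc)
  have "forward ?x ?t z" if z: "forward ?x ?v z" for z
  proof -
    have zv: "(?x, z) \<in> E" "(z, ?v) \<in> E\<^sup>*" "gdist E ?x ?v = Suc (gdist E z ?v)"
      using z unfolding forward_def by auto
    have zt: "(z, ?t) \<in> E\<^sup>*" using zv(2) vt(1) by (rule rtrancl_trans)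
    have "gdist E z ?t \<le> gdist E z ?v + gdist E ?v ?t" by (rule gdist_triangle[OF zv(2) vt(1)])
    moreover have "gdist E ?x ?t \<le> gdist E ?x z + gdist E z ?t" using zv(1) zt by (intro gdist_triangle) auto
    ultimately show ?thesis
      unfolding forward_def using zv zt gdist_arc[OF zv(1)] vt xv assms by auto
  qed
  then have "label ?y \<le> label z" if "forward ?x ?v z" for z
    using that arg_min_nat_le[of "forward ?x ?t" z label] by (simp add: hop_def)
  moreover have w: "forward ?x ?v (hop ?x ?v)" unfolding hop_def using y by (rule arg_min_natI)
  moreover have "label (hop ?x ?v) \<le> label ?y" unfolding hop_def using y by (rule arg_min_nat_le)
  ultimately have "label (hop ?x ?v) = label ?y" by (meson le_antisym)
  moreover have "hop ?x ?v \<in> V" "?y \<in> V" using w y E_subset unfolding forward_def by auto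
  ultimately show ?thesis using label_inj by (auto dest: inj_onD)
qed

lemma spath_subpath:
  assumes "i \<le> j" "j \<le> slen a" "m \<le> j - i"
  shows "spath (spath a i, spath a j) m = spath a (i + m)"
  using assms(3)
proof (induction m)
  case (Suc m)
  then show ?case using hop_eq_hop_subpath[of "i + m" j] assms by simp
qed simp

lemma spath_in_V: "\<lbrakk>a \<in> V \<times> V; i \<le> slen a\<rbrakk> \<Longrightarrow> spath a i \<in> V"
  using spath_arc[of "i - 1"] E_subset by (cases i) auto

end

text \<open>Both distances refer to the same vertex of the path, so a round trip from
  \<open>z\<close> has length at most \<open>2 * R\<close>. Reachability gives the two values of
  \<open>gdist\<close> their meaning.\<close>

definition near :: "nat \<Rightarrow> 'a \<Rightarrow> 'a \<times> 'a \<Rightarrow> bool" where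
  "near R z a \<longleftrightarrow> (\<exists>i\<le>slen a. (z, spath a i) \<in> E\<^sup>* \<and> (spath a i, z) \<in> E\<^sup>* \<and>
     gdist E z (spath a i) \<le> R \<and> gdist E (spath a i) z \<le> R)"

section \<open>Unions of canonical paths\<close>

context
  fixes P :: "('a \<times> 'a) set" assumes P: "P \<subseteq> V \<times> V" "P \<subseteq> E\<^sup>*"
begin

text \<open>If two canonical paths meet two vertices in the same order, both follow the canonical
  path between these vertices, by \<open>spath_subpath\<close>.\<close>

lemma path_system_spath: "path_system V P slen spath"
proof
  show "finite V" by (rule finite_V)
  show "finite P" using P finite_V by (meson finite_SigmaI finite_subset)
  show "spath a i \<in> V" if "a \<in> P" "i \<le> slen a" for a i
    using that P by (intro spath_in_V) auto
  show "inj_on (spath a) {..slen a}" if "a \<in> P" for a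
  proof (rule linorder_inj_onI)
    fix i j assume "i < j" "i \<in> {..slen a}" "j \<in> {..slen a}"
    then show "spath a i \<noteq> spath a j" using gdist_spath[of a i j] that P by auto
  qed auto
  fix a b i j k l
  assume A: "a \<in> P" "b \<in> P" "i < j" "j \<le> slen a" "k < l" "l \<le> slen b"
    "spath a i = spath b k" "spath a j = spath b l"
  have ab: "a \<in> E\<^sup>*" "b \<in> E\<^sup>*" using A P by auto
  have *: "j - i = l - k" using gdist_spath[OF ab(1), of i j] gdist_spath[OF ab(2), of k l] A by simp
  moreover have "spath a (i + m) = spath b (k + m)" if "m \<le> j - i" for m
    using spath_subpath[OF ab(1), of i j m] spath_subpath[OF ab(2), of k l m] A * that by simp
  ultimately show "j - i = l - k \<and> (\<forall>m\<le>j - i. spath a (i + m) = spath b (k + m))" by simp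
qed

interpretation sys: path_system V P slen spath by (rule path_system_spath)

lemma path_arcs_subset: "sys.path_arcs P \<subseteq> E"
  unfolding sys.path_arcs_def using spath_arc P by blast

lemma relpow_path_arcs:
  assumes "(s, t) \<in> P" shows "(s, t) \<in> sys.path_arcs P ^^ gdist E s t"
proof -
  have "(s, t) \<in> E\<^sup>*" using assms P by auto
  moreover have "(spath (s, t) i, spath (s, t) (Suc i)) \<in> sys.path_arcs P" if "i < slen (s, t)" for i
    unfolding sys.path_arcs_def using assms that by blast
  ultimately show ?thesis
    using spath_relpow[of "(s, t)" "sys.path_arcs P" 0 "slen (s, t)"] spath_end[of "(s, t)"]
    by (simp add: slen_def)
qed

text \<open>The vertex \<open>z\<close> is the hub, and an arc changes distances from or to it by at
  most one in the relevant direction. As each path is shortest, the part after \<open>st a\<close>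
  is no longer than the detour through \<open>z\<close>, and likewise the part before.\<close>

lemma card_path_arcs_near:
  assumes "Q \<subseteq> P" "\<forall>a\<in>Q. near R z a"
  shows "real (card (sys.path_arcs Q)) \<le> 2 * card V + (2 * sqrt (card V) + 4 * real R) * card Q"
proof -
  from assms(2) have "\<forall>a\<in>Q. \<exists>i. i \<le> slen a \<and> (z, spath a i) \<in> E\<^sup>* \<and> (spath a i, z) \<in> E\<^sup>* \<and>
     gdist E z (spath a i) \<le> R \<and> gdist E (spath a i) z \<le> R"
    unfolding near_def by auto
  then obtain st where st: "st a \<le> slen a" "(z, spath a (st a)) \<in> E\<^sup>*" "(spath a (st a), z) \<in> E\<^sup>*"
     "gdist E z (spath a (st a)) \<le> R" "gdist E (spath a (st a)) z \<le> R" if "a \<in> Q" for a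
    by (metis bchoice)
  have reach: "a \<in> E\<^sup>*" if "a \<in> Q" for a using that assms P by auto
  show ?thesis
  proof (rule sys.card_path_arcs_le_hub[OF assms(1), where st = st and f = "gdist E z" and g = "\<lambda>x. gdist E x z"])
    fix a assume a: "a \<in> Q"
    note ra = reach[OF a]
    show "slen a \<le> st a + R + gdist E z (spath a (slen a))"
    proof -
      have "(z, spath a (slen a)) \<in> E\<^sup>*"
        using st(2)[OF a] spath_reach[OF ra st(1)[OF a] order_refl] by (rule rtrancl_trans)
      then have "gdist E (spath a (st a)) (spath a (slen a))
          \<le> gdist E (spath a (st a)) z + gdist E z (spath a (slen a))"
        by (intro gdist_triangle st(3) a)
      then show ?thesis using gdist_spath[OF ra st(1)[OF a]] st(5)[OF a] by simp
    qed
    show "st a \<le> R + gdist E (spath a 0) z"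
    proof -
      have "(spath a 0, z) \<in> E\<^sup>*"
        using spath_reach[OF ra _ st(1)[OF a], of 0] st(3)[OF a] by (auto intro: rtrancl_trans)
      then have "gdist E (spath a 0) (spath a (st a)) \<le> gdist E (spath a 0) z + gdist E z (spath a (st a))"
        by (intro gdist_triangle st(2) a)
      then show ?thesis using gdist_spath[OF ra _ st(1)[OF a], of 0] st(4)[OF a] by simp
    qed
  next
    fix a i assume a: "a \<in> Q" "st a \<le> i" "i < slen a"
    note ra = reach[OF a(1)]
    have reach_z: "(z, spath a i) \<in> E\<^sup>*"
      using st(2)[OF a(1)] spath_reach[OF ra a(2)] a(3) by (auto intro: rtrancl_trans)
    show "gdist E z (spath a (Suc i)) \<le> gdist E z (spath a i) + 1"
      using gdist_triangle[OF reach_z r_into_rtrancl[OF spath_arc[OF ra a(3)]]]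
        gdist_arc[OF spath_arc[OF ra a(3)]] by linarith
  next
    fix a i assume a: "a \<in> Q" "i < st a"
    note ra = reach[OF a(1)]
    have i: "i < slen a" using a st(1)[OF a(1)] by simp
    have reach_z: "(spath a (Suc i), z) \<in> E\<^sup>*"
      using spath_reach[OF ra _ st(1)[OF a(1)], of "Suc i"] st(3)[OF a(1)] a(2)
      by (auto intro: rtrancl_trans simp del: spath_Suc)
    show "gdist E (spath a i) z \<le> gdist E (spath a (Suc i)) z + 1"
      using gdist_triangle[OF r_into_rtrancl[OF spath_arc[OF ra i]] reach_z]
        gdist_arc[OF spath_arc[OF ra i]] by linarith
  qed (use st in auto)
qed

text \<open>The pieces of \<open>a\<close> and \<open>b\<close> form a closed walk of length at most
  \<open>r\<close>, on which any two vertices are within \<open>r\<close> of each other both ways.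
  The vertex \<open>spath b k\<close> on it shows that \<open>spath a m\<close> is near
  \<open>b\<close>.\<close>

lemma card_path_arcs_no_hub:
  fixes D :: real
  assumes Q: "Q \<subseteq> P" and "r > 0"
    and light: "\<forall>z\<in>V. real (card {a\<in>Q. near r z a}) \<le> D"
  shows "(real (card (sys.path_arcs Q)))\<^sup>2 \<le> card V * (card (sys.path_arcs Q) * (1 + sqrt (2 * D))
    + (real (card Q))\<^sup>2 + 2 * card Q * card V * D / r)"
proof (rule sys.card_path_arcs_light[OF Q assms(2), where near = "near r"])
  show "near r (spath a i) a" if "a \<in> Q" "i \<le> slen a" for a i
    unfolding near_def using that by (intro exI[of _ i]) auto
  show "real (card {a\<in>Q. near r z a}) \<le> D" if "z \<in> V" for z using light that by auto
  fix a b i j k l m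
  assume A: "a \<in> Q" "b \<in> Q" "i < m" "m \<le> j" "j \<le> slen a" "k < l" "l \<le> slen b"
    "spath a i = spath b l" "spath a j = spath b k" "j - i + (l - k) \<le> r"
  have ab: "a \<in> E\<^sup>*" "b \<in> E\<^sup>*" using A Q P by auto
  have 1: "(spath a m, spath b k) \<in> E\<^sup>*" "gdist E (spath a m) (spath b k) = j - m"
    using spath_reach[OF ab(1) A(4,5)] gdist_spath[OF ab(1) A(4,5)] A by auto
  have 2: "(spath b k, spath b l) \<in> E\<^sup>*" "gdist E (spath b k) (spath b l) = l - k"
    using spath_reach[OF ab(2), of k l] gdist_spath[OF ab(2), of k l] A by auto
  have 3: "(spath b l, spath a m) \<in> E\<^sup>*" "gdist E (spath b l) (spath a m) = m - i"
    using spath_reach[OF ab(1), of i m] gdist_spath[OF ab(1), of i m] A by auto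
  have 4: "(spath b k, spath a m) \<in> E\<^sup>*" using 2(1) 3(1) by (rule rtrancl_trans)
  have 5: "gdist E (spath b k) (spath a m) \<le> l - k + (m - i)"
    using gdist_triangle[OF 2(1) 3(1)] 2(2) 3(2) by simp
  show "near r (spath a m) b"
    unfolding near_def using 1 4 5 A by (intro exI[of _ k]) auto
qed

text \<open>With \<open>n = x^6\<close> and \<open>p = y^3\<close> all exponents become integral. The thresholds \<open>D = x y\<close> and
  \<open>r = x^5 / y\<close> equate the costs of the hubs and of the pieces of paths close to them with
  the target \<open>x^5 y^2\<close>.\<close>

lemma card_path_arcs_intermediate:
  fixes x y :: real
  assumes x: "x \<ge> 1" "real (card V) = x ^ 6" and y: "real (card P) = y ^ 3" "x \<le> y" "y \<le> x\<^sup>2"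
  shows "real (card (sys.path_arcs P)) \<le> 16 * (x ^ 5 * y\<^sup>2)"
proof -
  define T where "T = x ^ 5 * y\<^sup>2"
  define D where "D = x * y"
  define r where "r = nat \<lceil>x ^ 5 / y\<rceil>"
  have pos: "x > 0" "y > 0" "y \<ge> 1" "T > 0" "D > 0" unfolding T_def D_def using x y by auto
  have sqrt_n: "sqrt (card V) = x ^ 3"
    unfolding x(2) using pos by (intro real_sqrt_unique) (auto simp flip: power_mult)
  \<comment> \<open>This makes the quotient defining \<open>r\<close> at least 1, so rounding up at
    most doubles it.\<close>
  have "y \<le> x ^ 5"
    using y(3) power_increasing[of 2 5 x] x(1) by linarith
  then have ge1: "x ^ 5 / y \<ge> 1" using pos by simp
  then have r: "x ^ 5 / y \<le> r" "r \<le> 2 * (x ^ 5 / y)" "r > 0"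
    unfolding r_def using of_int_ceiling_le_add_one[of "x ^ 5 / y"] by linarith+
  have light: "real (card (sys.path_arcs Q)) \<le> 4 * T"
    if Q: "Q \<subseteq> P" "\<forall>z\<in>V. real (card {a\<in>Q. near r z a}) \<le> D" for Q
  proof -
    define I where "I = real (card (sys.path_arcs Q))"
    have I: "I \<ge> 0" unfolding I_def by simp
    have q: "real (card Q) \<le> y ^ 3"
      unfolding y(1)[symmetric] using Q sys.finite_P by (simp add: card_mono)
    have "I\<^sup>2 \<le> x ^ 6 * (I * (1 + sqrt (2 * D)) + (real (card Q))\<^sup>2 + 2 * card Q * x ^ 6 * D / r)"
      using card_path_arcs_no_hub[OF Q(1) r(3) Q(2)] unfolding I_def by (simp add: x(2))
    also have "\<dots> = I * (x ^ 6 * (1 + sqrt (2 * D))) + x ^ 6 * (real (card Q))\<^sup>2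
        + 2 * x ^ 12 * card Q * (D / r)"
      by (simp add: algebra_simps flip: power_add)
    also have "x ^ 6 * (1 + sqrt (2 * D)) \<le> 3 * T"
    proof -
      have "2 * (x * y) \<le> (2 * y)\<^sup>2"
        using y pos mult_right_mono[of x y y] by (simp add: power2_eq_square)
      then have "sqrt (2 * D) \<le> 2 * y" unfolding D_def using pos by (intro real_le_lsqrt) auto
      then have "x ^ 6 * (1 + sqrt (2 * D)) \<le> x ^ 6 * (3 * y)" using pos by (intro mult_left_mono) auto
      also have "\<dots> = 3 * (x ^ 5 * y) * x" by (simp add: algebra_simps eval_nat_numeral)
      also have "\<dots> \<le> 3 * (x ^ 5 * y) * y" using y pos by (intro mult_left_mono) auto
      finally show ?thesis unfolding T_def by (simp add: power2_eq_square algebra_simps)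
    qed
    also have "x ^ 6 * (real (card Q))\<^sup>2 \<le> T\<^sup>2"
    proof -
      have "x ^ 6 * (real (card Q))\<^sup>2 \<le> x ^ 6 * (y ^ 3)\<^sup>2" using q pos by (intro mult_left_mono power_mono) auto
      also have "\<dots> = x ^ 6 * y ^ 4 * y\<^sup>2" by (simp flip: power_mult power_add)
      also have "\<dots> \<le> x ^ 6 * y ^ 4 * (x\<^sup>2)\<^sup>2" using y pos by (intro mult_left_mono power_mono) auto
      also have "\<dots> = T\<^sup>2" unfolding T_def by (simp add: power_mult_distrib flip: power_mult power_add)
      finally show ?thesis .
    qed
    also have "2 * x ^ 12 * card Q * (D / r) \<le> 2 * T\<^sup>2"
    proof -
      have "x ^ 5 \<le> r * y" using r pos by (simp add: field_simps)
      then have "y * x ^ 5 \<le> y * (r * y)" using pos by (intro mult_left_mono) auto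
      then have "x * y * x ^ 4 \<le> y\<^sup>2 * r" by (simp add: eval_nat_numeral algebra_simps)
      then have "D / r \<le> y\<^sup>2 / x ^ 4" unfolding D_def using r pos by (simp add: divide_simps)
      then have "2 * x ^ 12 * card Q * (D / r) \<le> 2 * x ^ 12 * y ^ 3 * (y\<^sup>2 / x ^ 4)"
        using q pos r by (intro mult_mono) auto
      also have "\<dots> = 2 * x ^ 8 * y ^ 4 * y" using pos by (simp add: field_simps eval_nat_numeral)
      also have "\<dots> \<le> 2 * x ^ 8 * y ^ 4 * x\<^sup>2" using y pos by (intro mult_left_mono) auto
      also have "\<dots> = 2 * T\<^sup>2" unfolding T_def by (simp add: power_mult_distrib flip: power_mult power_add)
      finally show ?thesis .
    qed
    finally have le: "I\<^sup>2 \<le> I * (3 * T) + 3 * T\<^sup>2" using I by (simp add: mult_left_mono)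
    \<comment> \<open>The inequality fails for larger values, since 16 > 3 * 4 + 3.\<close>
    show "I \<le> 4 * T"
    proof (rule ccontr)
      assume "\<not> ?thesis"
      then have g: "4 * T < I" by simp
      then have "0 < I" using pos by linarith
      have "4 * (T * T) < I * T" using mult_strict_right_mono[OF g pos(4)] by (simp add: mult.assoc)
      moreover have "4 * (I * T) < I * I"
        using mult_strict_left_mono[OF g \<open>0 < I\<close>] by (simp add: mult.left_commute)
      moreover have "I * I \<le> 3 * (I * T) + 3 * (T * T)"
        using le by (simp add: power2_eq_square mult.left_commute)
      moreover have "0 < T * T" using pos by simp
      ultimately show False by linarith
    qed
  qed
  \<comment> \<open>In units of \<open>T\<close>, the fixed hub costs give 2, the single crossings
    2, the pieces close to hubs 8 and the light rest 4, in all 16.\<close>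
  have "real (card (sys.path_arcs P)) \<le> card P * (2 * card V / D + (2 * sqrt (card V) + 4 * real r)) + 4 * T"
    by (rule sys.card_path_arcs_greedy[where near = "near r"])
      (use pos card_path_arcs_near light in auto)
  also have "card P * (2 * card V / D + (2 * sqrt (card V) + 4 * real r))
      = 2 * (x ^ 6 * y ^ 3 / D) + 2 * (x ^ 3 * y ^ 3) + 4 * (y ^ 3 * r)"
    unfolding sqrt_n y(1) by (simp add: x(2) algebra_simps)
  also have "x ^ 6 * y ^ 3 / D = T"
    unfolding D_def T_def using pos by (simp add: field_simps eval_nat_numeral)
  also have "x ^ 3 * y ^ 3 \<le> T"
  proof -
    have "x ^ 3 * y\<^sup>2 * y \<le> x ^ 3 * y\<^sup>2 * x\<^sup>2" using y pos by (intro mult_left_mono) auto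
    then show ?thesis unfolding T_def by (simp add: eval_nat_numeral algebra_simps)
  qed
  also have "y ^ 3 * r \<le> 2 * T"
  proof -
    have "y ^ 3 * r \<le> y ^ 3 * (2 * (x ^ 5 / y))" using r pos by (intro mult_left_mono) auto
    also have "\<dots> = 2 * T" unfolding T_def using pos by (simp add: field_simps eval_nat_numeral)
    finally show ?thesis .
  qed
  finally show ?thesis unfolding T_def by (simp add: mult_ac)
qed

text \<open>With n vertices and p paths the cases are p <= n^(1/2), settled by triples; n^(1/2) <= p
  <= n, settled by hubs; and p >= n, settled by ordered pairs.\<close>

lemma card_path_arcs:
  "real (card (sys.path_arcs P)) \<le>
     16 * (real (card V) powr (5/6) * real (card P) powr (2/3) + real (card V))"
proof (cases "P = {}")
  case True
  then show ?thesis by (simp add: sys.path_arcs_def)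
next
  case False
  have VP: "card V \<ge> 1" "card P \<ge> 1"
    using False P finite_V sys.finite_P by (auto simp: Suc_le_eq card_gt_0_iff)
  define x where "x = real (card V) powr (1/6)"
  define y where "y = real (card P) powr (1/3)"
  have x: "x \<ge> 1" "x ^ 6 = card V" and x5: "real (card V) powr (5/6) = x ^ 5"
    unfolding x_def using VP by (auto simp: ge_one_powr_ge_zero powr_powr simp flip: powr_realpow)
  have y: "y \<ge> 1" "y ^ 3 = card P" and y2: "real (card P) powr (2/3) = y\<^sup>2"
    unfolding y_def using VP by (auto simp: ge_one_powr_ge_zero powr_powr simp flip: powr_realpow)
  have "real (card (sys.path_arcs P)) \<le> 16 * (x ^ 5 * y\<^sup>2 + x ^ 6)"
  proof -
    consider "y \<le> x" | "x \<le> y" "y \<le> x\<^sup>2" | "x\<^sup>2 \<le> y" by linarith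
    then show ?thesis
    proof cases
      case 1
      have "root 3 (card V) = x\<^sup>2"
        using x by (intro real_root_pos_unique) (auto simp flip: power_mult)
      then have "real (card (sys.path_arcs P)) \<le> 15 * x ^ 6 + 3 * (x ^ 4 * y ^ 3)"
        using sys.card_path_arcs_le_triples[OF order_refl] x y by (simp flip: power_mult)
      moreover have "x ^ 4 * y ^ 3 \<le> x ^ 5 * y\<^sup>2"
      proof -
        have "x ^ 4 * y\<^sup>2 * y \<le> x ^ 4 * y\<^sup>2 * x" using 1 x y by (intro mult_left_mono) auto
        then show ?thesis by (simp add: eval_nat_numeral algebra_simps)
      qed
      moreover have "0 \<le> x ^ 5 * y\<^sup>2" "0 \<le> x ^ 6" using x(1) by simp_all
      ultimately show ?thesis unfolding distrib_left by linarith
    next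
      case 2
      have "real (card (sys.path_arcs P)) \<le> 16 * (x ^ 5 * y\<^sup>2)"
        by (rule card_path_arcs_intermediate) (use x y 2 in auto)
      also have "\<dots> \<le> 16 * (x ^ 5 * y\<^sup>2 + x ^ 6)" using x by simp
      finally show ?thesis .
    next
      case 3
      \<comment> \<open>The pair bound has a summand linear in p. Since p <= n^2, that is y <= x^4,
        it stays below the target.\<close>
      have "real (card P) \<le> real (card (V \<times> V))"
        using P finite_V by (intro of_nat_mono card_mono) auto
      then have "y ^ 3 \<le> (x ^ 4) ^ 3"
        unfolding y(2) by (simp add: card_cartesian_product flip: power_mult x(2) power_add)
      then have "y \<le> x ^ 4" using x y by (meson power_mono_iff zero_less_numeral zero_le_power order_trans zero_le_one)
      also have "\<dots> \<le> x ^ 5" using x by (intro power_increasing) auto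
      finally have "y * y\<^sup>2 \<le> x ^ 5 * y\<^sup>2" by (intro mult_right_mono) auto
      then have p: "real (card P) \<le> x ^ 5 * y\<^sup>2" unfolding y(2)[symmetric] by (simp add: eval_nat_numeral)
      have "x\<^sup>2 * y ^ 3 \<le> y * y ^ 3" using 3 y by (intro mult_right_mono) auto
      then have "(x * sqrt (y ^ 3))\<^sup>2 \<le> (y\<^sup>2)\<^sup>2"
        using y(1) by (simp add: power_mult_distrib flip: power_mult power_Suc)
      then have "x * sqrt (y ^ 3) \<le> y\<^sup>2" by (rule power2_le_imp_le) simp
      then have "x ^ 5 * (x * sqrt (y ^ 3)) \<le> x ^ 5 * y\<^sup>2" using x by (intro mult_left_mono) auto
      then have np: "card V * sqrt (card P) \<le> x ^ 5 * y\<^sup>2"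
        unfolding x(2)[symmetric] y(2)[symmetric] by (simp add: eval_nat_numeral algebra_simps)
      have "real (card (sys.path_arcs P)) \<le> 2 * card P + 2 * (card V * sqrt (card P))"
        using sys.card_path_arcs_le_pairs[OF order_refl] by simp
      also have "\<dots> \<le> 4 * (x ^ 5 * y\<^sup>2)" using p np by simp
      also have "\<dots> \<le> 16 * (x ^ 5 * y\<^sup>2 + x ^ 6)" using x y by (simp add: add_increasing2)
      finally show ?thesis .
    qed
  qed
  then show ?thesis using x x5 y2 by simp
qed

end

end

text \<open>A walk of length \<open>gdist E s t\<close> inside \<open>F\<close> is all that
  preservation requires, because walks in a subset of \<open>E\<close> cannot be shorter. The labels
  come from any numbering of \<open>V\<close>.\<close>

theorem relation_distance_preserver:
  assumes "finite V" "E \<subseteq> V \<times> V" "P \<subseteq> V \<times> V" "P \<subseteq> E\<^sup>*"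
  obtains F where "F \<subseteq> E" "\<And>s t. (s, t) \<in> P \<Longrightarrow> (s, t) \<in> F ^^ gdist E s t"
    "real (card F) \<le> 16 * (real (card V) powr (5/6) * real (card P) powr (2/3) + real (card V))"
proof -
  obtain label :: "'a \<Rightarrow> nat" where "inj_on label V"
    using finite_imp_inj_to_nat_seg[OF assms(1)] by blast
  then interpret labelled_digraph V E label using assms by unfold_locales
  show thesis
    using that[of "path_system.path_arcs slen spath P"] path_arcs_subset[OF assms(3,4)]
      relpow_path_arcs[OF assms(3,4)] card_path_arcs[OF assms(3,4)] by blast
qed

section \<open>Transfer to digraphs\<close>

text \<open>That \<open>u\<close> is a vertex matters for k = 0: the zeroth power relates all
  elements to themselves, but empty walks start at vertices.\<close>

lemma awalk_with_proj_relpow: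
  assumes "pair_wf_digraph G" "u \<in> pverts G"
  shows "(\<exists>q. pre_digraph.awalk (with_proj G) u q v \<and> length q = k) \<longleftrightarrow> (u, v) \<in> parcs G ^^ k"
  using assms(2)
proof (induction k arbitrary: u)
  interpret pair_wf_digraph G by (rule assms(1))
  case 0
  then show ?case by (auto simp: awalk_Nil_iff)
next
  interpret pair_wf_digraph G by (rule assms(1))
  case (Suc k)
  have "(\<exists>q. awalk u q v \<and> length q = Suc k) \<longleftrightarrow>
      (\<exists>w. (u, w) \<in> parcs G \<and> (\<exists>q. awalk w q v \<and> length q = k))"
  proof (intro iffI; elim exE conjE)
    fix q assume "awalk u q v" "length q = Suc k"
    then show "\<exists>w. (u, w) \<in> parcs G \<and> (\<exists>q. awalk w q v \<and> length q = k)"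
      by (cases q) (auto simp: awalk_Cons_iff, blast)
  next
    fix w q assume "(u, w) \<in> parcs G" "awalk w q v" "length q = k"
    then show "\<exists>q. awalk u q v \<and> length q = Suc k"
      by (intro exI[of _ "(u, w) # q"]) (auto simp: awalk_Cons_iff)
  qed
  also have "\<dots> \<longleftrightarrow> (\<exists>w. (u, w) \<in> parcs G \<and> (w, v) \<in> parcs G ^^ k)"
    using Suc.IH in_arcsD2 by blast
  also have "\<dots> \<longleftrightarrow> (u, v) \<in> parcs G ^^ Suc k" 
    by (blast intro: relpow_Suc_I2 elim: relpow_Suc_E2)
  finally show ?case .
qed

lemma hop_dist_eq_gdist:
  assumes "pair_wf_digraph G" "u \<in> pverts G" "(u, v) \<in> (parcs G)\<^sup>*"
  shows "hop_dist (with_proj G) u v = ereal (gdist (parcs G) u v)"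
proof -
  interpret pair_wf_digraph G by (rule assms(1))
  have cost: "awalk_cost (\<lambda>_. 1) q = length q" for q by (induction q) auto
  show ?thesis
    unfolding hop_dist_def \<mu>_def
  proof (rule antisym)
    obtain q where "awalk u q v" "length q = gdist (parcs G) u v"
      using awalk_with_proj_relpow[OF assms(1,2)] gdist_relpow[OF assms(3)] by blast
    then show "(INF q\<in>{q. awalk u q v}. ereal (awalk_cost (\<lambda>_. 1) q)) \<le> ereal (gdist (parcs G) u v)"
      by (intro INF_lower2[of q]) (auto simp: cost)
    show "ereal (gdist (parcs G) u v) \<le> (INF q\<in>{q. awalk u q v}. ereal (awalk_cost (\<lambda>_. 1) q))"
    proof (rule INF_greatest)
      fix q assume "q \<in> {q. awalk u q v}"
      then have "(u, v) \<in> parcs G ^^ length q"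
        using awalk_with_proj_relpow[OF assms(1,2)] by blast
      then show "ereal (gdist (parcs G) u v) \<le> ereal (awalk_cost (\<lambda>_. 1) q)"
        by (simp add: cost gdist_le)
    qed
  qed
qed

theorem theorem5p1:
  shows "\<exists>(C :: real) (c :: nat). \<forall>(G :: 'a pair_pre_digraph) (P :: ('a \<times> 'a) set) (n :: nat) (p :: nat).
    pair_fin_digraph G \<and> card (pverts G) = n \<and> demand_pairs (with_proj G) P \<and> card P = p \<longrightarrow>
    (\<exists>H :: 'a pair_pre_digraph.
       exact_distance_preserver (with_proj G) P (with_proj H) \<and>
       real (card (parcs H)) \<le>
         C * polylog c n * (real n powr (5/6) * real p powr (2/3) + real n))"
proof (intro exI[of _ "16 :: real"] exI[of _ "0 :: nat"] allI impI, elim conjE)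
  \<comment> \<open>The constant is that of \<open>relation_distance_preserver\<close>; the exponent
    is 0 because that bound is free of logarithms.\<close>
  fix G :: "'a pair_pre_digraph" and P :: "('a \<times> 'a) set" and n p :: nat
  assume G: "pair_fin_digraph G" and n: "card (pverts G) = n"
    and P: "demand_pairs (with_proj G) P" and p: "card P = p"
  interpret pair_fin_digraph G by (rule G)
  have PV: "P \<subseteq> pverts G \<times> pverts G" and PE: "P \<subseteq> (parcs G)\<^sup>*"
    using P reachable_rtranclI[of "with_proj G"] unfolding demand_pairs_def by auto
  have EV: "parcs G \<subseteq> pverts G \<times> pverts G" using in_arcsD1 in_arcsD2 by auto
  from relation_distance_preserver[OF pair_finite_verts EV PV PE]
  obtain F where F: "F \<subseteq> parcs G" "\<And>s t. (s, t) \<in> P \<Longrightarrow> (s, t) \<in> F ^^ gdist (parcs G) s t"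
    "real (card F) \<le> 16 * (real n powr (5/6) * real p powr (2/3) + real n)"
    unfolding n p by blast
  \<comment> \<open>All vertices are kept, so the demand endpoints are vertices of
    \<open>H\<close>.\<close>
  define H where "H = \<lparr>pverts = pverts G, parcs = F\<rparr>"
  have H: "pverts H = pverts G" "parcs H = F" unfolding H_def by auto
  have FV: "F \<subseteq> pverts G \<times> pverts G" using F(1) EV by (rule order_trans)
  have wf_H: "pair_wf_digraph H"
    using FV by unfold_locales (auto simp: H)
  have "subgraph (with_proj H) (with_proj G)"
    unfolding subgraph_def
    using F(1) FV wf_H wf_digraph_axioms by (auto simp: H wf_digraph_wp_iff)
  moreover have "hop_dist (with_proj H) s t = hop_dist (with_proj G) s t" if st: "(s, t) \<in> P" for s t
  proof -
    have s: "s \<in> pverts G" using st PV by auto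
    have stF: "(s, t) \<in> F\<^sup>*" using F(2)[OF st] by (rule relpow_imp_rtrancl)
    have stE: "(s, t) \<in> (parcs G)\<^sup>*" using st PE by auto
    have "gdist F s t \<le> gdist (parcs G) s t" using F(2)[OF st] by (rule gdist_le)
    moreover have "(s, t) \<in> parcs G ^^ gdist F s t"
      using gdist_relpow[OF stF] relpow_mono[OF F(1)] by blast
    then have "gdist (parcs G) s t \<le> gdist F s t" by (rule gdist_le)
    ultimately show ?thesis
      using hop_dist_eq_gdist[OF wf_H, of s t] hop_dist_eq_gdist[OF pair_wf_digraph_axioms s stE] stF s
      by (simp add: H)
  qed
  ultimately have "exact_distance_preserver (with_proj G) P (with_proj H)"
    unfolding exact_distance_preserver_def by auto
  then show "\<exists>H. exact_distance_preserver (with_proj G) P (with_proj H) \<and>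
       real (card (parcs H)) \<le> 16 * polylog 0 n * (real n powr (5/6) * real p powr (2/3) + real n)"
    using F(3) H by (auto simp: polylog_def)
qed

end
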